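(* Let $N\ge1$, let $q$ be real with $0<|q|<1$, and let $0<r<\frac{1-|q|}{|1-q|}$. For the $N$-particle $q$-TAZRP, for all $X=(x_N,\dots,x_1)\in\mathbf{S}$, $Y=(y_N,\dots,y_1)\in\mathbf{S}$ and $t\ge0$, $$P_Y(X;t)=W_X\Big(\frac{1}{2\pi i}\Big)^N\oint_{\mathcal{C}_r}\cdots\oint_{\mathcal{C}_r}\sum_{\sigma\in\mathbb{S}_N}A_\sigma\prod_{i=1}^N z_{\sigma(i)}^{x_i-y_{\sigma(i)}-1}e^{\epsilon(z_i)t}\,dz_1\cdots dz_N,$$ where $W_X=1\big/\prod_{\mathbf{x}\in\Lambda(X)}[\eta_X(\mathbf{x})]_q!$ and $\epsilon(z)=\frac1z-1$.
   Context: $[k]_q=1+q+\cdots+q^{k-1}$, $[k]_q!=[1]_q\cdots[k]_q$. $\mathbf{S}=\{(x_N,\dots,x_1)\in\mathbb{Z}^N:x_N\le\cdots\le x_1\}$ is the set of configurations of $N$ indistinguishable particles on $\mathbb{Z}$ ($x_j$ is the position of the $j$-th right-most particle; several particles may share a site). $\Lambda(X)$ is the set of occupied sites of $X$ and $\eta_X(\mathbf{x})$ the number of particles at site $\mathbf{x}$. The $q$-TAZRP is the continuous-time Markov chain on $\mathbf{S}$ in which, independently for each occupied site $\mathbf{x}$, one particle jumps from $\mathbf{x}$ to $\mathbf{x}+1$ at rate $[\eta(\mathbf{x})]_q$. $P_Y(X;t)$ is the probability that the process started at $Y$ is at $X$ at time $t$. $\mathcal{C}_r$ is the positively oriented circle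 of radius $r$ about $0$. For $1\le\alpha<\beta\le N$, $S_{\beta\alpha}=-\dfrac{z_\beta-qz_\alpha-(1-q)z_\alpha z_\beta}{z_\alpha-qz_\beta-(1-q)z_\alpha z_\beta}$; an inversion of $\sigma\in\mathbb{S}_N$ is a pair $(\alpha,\beta)$ with $\alpha<\beta$ and $\sigma^{-1}(\beta)<\sigma^{-1}(\alpha)$; $A_\sigma=\prod_{(\alpha,\beta)\text{ inversion of }\sigma}S_{\beta\alpha}$. *)

theory Defs
  imports "HOL-Analysis.Analysis" "HOL-Combinatorics.Permutations"
begin

definition qint :: "real \<Rightarrow> nat \<Rightarrow> real" where
  "qint q k = (\<Sum>i<k. q ^ i)"

definition qfact :: "real \<Rightarrow> nat \<Rightarrow> real" where
  "qfact q k = (\<Prod>i=1..k. qint q i)"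

text \<open>A configuration X = (x_N, ..., x_1) is a function nat => int with X j = x_j for
  1 <= j <= N, normalised to 0 outside {1..N}, with x_N <= ... <= x_1.\<close>

definition confs :: "nat \<Rightarrow> (nat \<Rightarrow> int) set" where
  "confs N = {X. (\<forall>j. 1 \<le> j \<longrightarrow> j < N \<longrightarrow> X (Suc j) \<le> X j) \<and>
                  (\<forall>j. (j = 0 \<or> N < j) \<longrightarrow> X j = 0)}"

definition eta :: "nat \<Rightarrow> (nat \<Rightarrow> int) \<Rightarrow> int \<Rightarrow> nat" where
  "eta N X x = card {j \<in> {1..N}. X j = x}"

definition occupied :: "nat \<Rightarrow> (nat \<Rightarrow> int) \<Rightarrow> int set" where
  "occupied N X = X ` {1..N}"

text \<open>one particle jumps from the occupied site x to x+1: in the ordered labelling this is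
  the particle at x with the smallest label (the right-most of those at x)\<close>
definition jump :: "nat \<Rightarrow> (nat \<Rightarrow> int) \<Rightarrow> int \<Rightarrow> (nat \<Rightarrow> int)" where
  "jump N X x = X ((LEAST j. 1 \<le> j \<and> j \<le> N \<and> X j = x) := x + 1)"

definition gen :: "nat \<Rightarrow> real \<Rightarrow> ((nat \<Rightarrow> int) \<Rightarrow> real) \<Rightarrow> (nat \<Rightarrow> int) \<Rightarrow> real" where
  "gen N q f Y = (\<Sum>x\<in>occupied N Y. qint q (eta N Y x) * (f (jump N Y x) - f Y))"

text \<open>transition probability P_Y(X;t) = (exp (t L)) (indicator of X) evaluated at Y
  (rates are bounded, so the transition semigroup is the exponential of the generator)\<close>
definition trans_prob :: "nat \<Rightarrow> real \<Rightarrow> (nat \<Rightarrow> int) \<Rightarrow> (nat \<Rightarrow> int) \<Rightarrow> real \<Rightarrow> real" where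
  "trans_prob N q Y X t =
     (\<Sum>n. t ^ n / fact n * ((gen N q ^^ n) (\<lambda>Z. if Z = X then 1 else 0) Y))"

definition weightW :: "nat \<Rightarrow> real \<Rightarrow> (nat \<Rightarrow> int) \<Rightarrow> real" where
  "weightW N q X = 1 / (\<Prod>x\<in>occupied N X. qfact q (eta N X x))"

definition circle_integral :: "real \<Rightarrow> (complex \<Rightarrow> complex) \<Rightarrow> complex" where
  "circle_integral r f =
     integral {0..2*pi} (\<lambda>\<theta>. f (of_real r * cis \<theta>) * (\<i> * of_real r * cis \<theta>))"

fun multi_circle_integral :: "real \<Rightarrow> nat \<Rightarrow> ((nat \<Rightarrow> complex) \<Rightarrow> complex) \<Rightarrow> complex" where
  "multi_circle_integral r 0 F = F (\<lambda>_. 0)"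
| "multi_circle_integral r (Suc n) F =
     circle_integral r (\<lambda>z. multi_circle_integral r n (\<lambda>zs. F (zs(Suc n := z))))"

definition Sfac :: "real \<Rightarrow> (nat \<Rightarrow> complex) \<Rightarrow> nat \<Rightarrow> nat \<Rightarrow> complex" where
  "Sfac q z \<beta> \<alpha> =
     - (z \<beta> - of_real q * z \<alpha> - (1 - of_real q) * z \<alpha> * z \<beta>) /
       (z \<alpha> - of_real q * z \<beta> - (1 - of_real q) * z \<alpha> * z \<beta>)"

definition inversions :: "nat \<Rightarrow> (nat \<Rightarrow> nat) \<Rightarrow> (nat \<times> nat) set" where
  "inversions N \<sigma> = {(\<alpha>, \<beta>). \<alpha> \<in> {1..N} \<and> \<beta> \<in> {1..N} \<and> \<alpha> < \<beta> \<and> inv \<sigma> \<beta> < inv \<sigma> \<alpha>}"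

definition Aperm :: "nat \<Rightarrow> real \<Rightarrow> (nat \<Rightarrow> nat) \<Rightarrow> (nat \<Rightarrow> complex) \<Rightarrow> complex" where
  "Aperm N q \<sigma> z = (\<Prod>(\<alpha>, \<beta>)\<in>inversions N \<sigma>. Sfac q z \<beta> \<alpha>)"

definition epsilon :: "complex \<Rightarrow> complex" where
  "epsilon z = 1 / z - 1"

end

(* Under the integral, moving particle j of Y one step to the right is multiplication by 1/z_j, so the
   free generator acts as multiplication by the sum of the epsilon(z_j).  The Bethe sum times the
   denominator of S_{k+1,k} is antisymmetric under z_k <-> z_{k+1}; this gives the boundary relation at
   y_k = y_{k+1}, which turns the free generator into the generator of the q-TAZRP acting on Y.
   Hence the n-th Taylor coefficient in t of the right-hand side is the n-th power of the generator
   applied to its value at t = 0, and no uniqueness theorem for the backward equation is needed.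

   At t = 0 each permutation is treated separately.  If j is a right-to-left minimum of the inverse
   permutation tau, the integrand extends analytically to the inside of the circle in z_j and the
   integral vanishes unless x_{tau j} <= y_j; if j is a left-to-right maximum it extends to the outside
   and the integral vanishes unless x_{tau j} >= y_j.  Together these force X = Y and tau to preserve
   the blocks of equal positions; the surviving terms are q^inv(tau), and they sum to 1/W_X. *)

theory Submission
  imports Defs "HOL-Complex_Analysis.Cauchy_Integral_Formula"
begin

section \<open>Averages over circles and tori\<close>

text \<open>Writing dz = i z d\<theta> turns the contour integral into an average over a torus: the
  exponent -1 is absorbed, and the measure is invariant under exchanging variables. The backward
  equation in \<open>Y\<close> is preferred to the forward equation in \<open>X\<close> because
  \<open>Y\<close> enters every term of the Bethe sum through one common monomial, and W_X, which
  depends on \<open>X\<close> alone, is a constant for it. The boundary relation comes from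
  antisymmetry and therefore holds only after integration, not pointwise in z. The radius condition
  means |q| + |1-q| r < 1. It keeps the denominator of \<open>Sfac q z \<beta> \<alpha>\<close> away
  from 0 when |z \<alpha>| = r and |z \<beta>| <= r, and also when |z \<beta>| = r and |z \<alpha>|
  >= r. A variable that occurs only in the role of \<beta> can thus be moved inwards, one that
  occurs only in the role of \<alpha> outwards; this is why the two kinds of extrema of tau appear.
  The factor exp(t/z) has an essential singularity at 0, so contours are shifted only at t =
  0.\<close>

definition circle_avg :: "real \<Rightarrow> nat \<Rightarrow> ((nat \<Rightarrow> complex) \<Rightarrow> complex) \<Rightarrow> (nat \<Rightarrow> complex) \<Rightarrow> complex" where
  "circle_avg r k F z = integral {0..2*pi} (\<lambda>\<theta>. F (z(k := of_real r * cis \<theta>))) / of_real (2*pi)"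

text \<open>The result remains a function of the point, so that averages over different coordinates
  are operators that can be composed and commuted; it is constant in the coordinates already
  averaged.\<close>

fun torus_avg :: "real \<Rightarrow> nat \<Rightarrow> ((nat \<Rightarrow> complex) \<Rightarrow> complex) \<Rightarrow> (nat \<Rightarrow> complex) \<Rightarrow> complex" where
  "torus_avg r 0 F = F"
| "torus_avg r (Suc n) F = circle_avg r (Suc n) (torus_avg r n F)"

text \<open>Pinning the coordinates outside {1..N} to 0 makes this a compact subset of the space of
  all sequences.\<close>

definition torus :: "real \<Rightarrow> nat \<Rightarrow> (nat \<Rightarrow> complex) set" where
  "torus r N = {z. (\<forall>i\<in>{1..N}. norm (z i) = r) \<and> (\<forall>i. i \<notin> {1..N} \<longrightarrow> z i = 0)}"

text \<open>The full average does not depend on the evaluation point; this point lies on the torus,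
  where continuity of the integrands is available, which the zero sequence of
  \<open>multi_circle_integral\<close> in general does not.\<close>

definition torus_base :: "real \<Rightarrow> nat \<Rightarrow> nat \<Rightarrow> complex" where
  "torus_base r N = (\<lambda>i. if i \<in> {1..N} then of_real r else 0)"

lemma torus_base_in_torus: "0 \<le> r \<Longrightarrow> torus_base r N \<in> torus r N"
  by (auto simp: torus_base_def torus_def)

lemma torus_norm: "z \<in> torus r N \<Longrightarrow> i \<in> {1..N} \<Longrightarrow> norm (z i) = r"
  by (auto simp: torus_def)

lemma torus_update:
  "z \<in> torus r N \<Longrightarrow> k \<in> {1..N} \<Longrightarrow> norm w = r \<Longrightarrow> z(k := w) \<in> torus r N"
  by (auto simp: torus_def)

lemma torus_update_cis:
  "0 \<le> r \<Longrightarrow> z \<in> torus r N \<Longrightarrow> k \<in> {1..N} \<Longrightarrow> z(k := of_real r * cis \<theta>) \<in> torus r N"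
  by (rule torus_update) (auto simp: norm_mult)

lemma torus_transpose:
  assumes "1 \<le> k" "k < N" "z \<in> torus r N"
  shows "z \<circ> Transposition.transpose k (Suc k) \<in> torus r N"
proof -
  have "Transposition.transpose k (Suc k) i \<in> {1..N} \<longleftrightarrow> i \<in> {1..N}" for i
    using assms by (auto simp: Transposition.transpose_def)
  then show ?thesis
    using assms(3) unfolding torus_def mem_Collect_eq o_apply by blast
qed

text \<open>Tychonoff: the torus is a product of circles and singletons.\<close>

lemma compact_torus: "compact (torus r N)"
proof -
  let ?S = "\<lambda>i. if i \<in> {1..N} then sphere (0::complex) r else {0}"
  have eq: "torus r N = PiE UNIV ?S"
    unfolding torus_def set_eq_iff
    by (fastforce simp: PiE_iff split: if_splits)
  have "compactin (product_topology (\<lambda>_::nat. euclidean) UNIV) (PiE UNIV ?S)"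
    unfolding compactin_PiE by (auto simp: compactin_euclidean_iff)
  then show ?thesis
    by (simp add: eq euclidean_product_topology compactin_euclidean_iff)
qed

lemma continuous_on_update:
  assumes "continuous_on A f" "continuous_on A g"
  shows "continuous_on A (\<lambda>x. (f x :: nat \<Rightarrow> complex)(k := g x))"
proof (rule continuous_on_coordinatewise_then_product)
  show "continuous_on A (\<lambda>x. ((f x)(k := g x)) i)" for i
    by (cases "i = k") (use assms in \<open>auto intro: continuous_on_product_then_coordinatewise\<close>)
qed

lemma continuous_on_circle_update:
  assumes "continuous_on A f" "continuous_on A g"
  shows "continuous_on A (\<lambda>x. (f x :: nat \<Rightarrow> complex)(k := of_real r * cis (g x)))"
  by (rule continuous_on_update) (use assms in \<open>auto intro: continuous_intros\<close>)

lemma continuous_on_circle: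
  assumes "continuous_on (torus r N) F" "0 \<le> r" "z \<in> torus r N" "k \<in> {1..N}"
  shows "continuous_on A (\<lambda>\<theta>. F (z(k := of_real r * cis \<theta>)))"
  by (rule continuous_on_compose2[OF assms(1)])
     (use assms in \<open>auto intro!: continuous_on_circle_update continuous_on_fst continuous_on_snd continuous_on_id continuous_on_const torus_update_cis\<close>)

lemma continuous_on_circle_avg:
  assumes "continuous_on (torus r N) F" "0 \<le> r" "k \<in> {1..N}"
  shows "continuous_on (torus r N) (circle_avg r k F)"
proof -
  have "continuous_on (torus r N \<times> cbox 0 (2*pi)) (\<lambda>(z, \<theta>). F (z(k := of_real r * cis \<theta>)))"
    unfolding case_prod_beta
    by (rule continuous_on_compose2[OF assms(1)])
       (use assms in \<open>auto intro!: continuous_on_circle_update continuous_on_fst continuous_on_snd continuous_on_id continuous_on_const torus_update_cis\<close>)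
  from integral_continuous_on_param[OF this] show ?thesis
    unfolding circle_avg_def[abs_def] by (auto intro!: continuous_intros)
qed

lemma continuous_on_torus_avg:
  assumes "continuous_on (torus r N) F" "0 \<le> r" "n \<le> N"
  shows "continuous_on (torus r N) (torus_avg r n F)"
  using assms(3) by (induction n) (use assms in \<open>auto intro!: continuous_on_circle_avg\<close>)

lemma circle_avg_cong:
  assumes "\<And>z. z \<in> torus r N \<Longrightarrow> F z = G z" "0 \<le> r" "k \<in> {1..N}" "z \<in> torus r N"
  shows "circle_avg r k F z = circle_avg r k G z"
  unfolding circle_avg_def using assms by (simp add: torus_update_cis)

lemma torus_avg_cong:
  assumes "\<And>z. z \<in> torus r N \<Longrightarrow> F z = G z" "0 \<le> r" "n \<le> N" "z \<in> torus r N"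
  shows "torus_avg r n F z = torus_avg r n G z"
  using assms(3,4)
  by (induction n arbitrary: z) (use assms in \<open>auto intro!: circle_avg_cong\<close>)

lemma circle_avg_add:
  assumes "continuous_on (torus r N) F" "continuous_on (torus r N) G"
    and "0 \<le> r" "k \<in> {1..N}" "z \<in> torus r N"
  shows "circle_avg r k (\<lambda>z. F z + G z) z = circle_avg r k F z + circle_avg r k G z"
  unfolding circle_avg_def
  by (subst integral_add)
     (use assms in \<open>auto intro!: integrable_continuous_real continuous_on_circle simp: add_divide_distrib\<close>)

lemma circle_avg_scale: "circle_avg r k (\<lambda>z. c * F z) z = c * circle_avg r k F z"
  by (simp add: circle_avg_def)

lemma circle_avg_const:
  assumes "\<And>w. F (z(k := w)) = c"
  shows "circle_avg r k F z = c"
  by (simp add: circle_avg_def assms scaleR_conv_of_real)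

lemma torus_avg_scale: "torus_avg r n (\<lambda>z. c * F z) z = c * torus_avg r n F z"
proof (induction n arbitrary: z)
  case (Suc n)
  have "torus_avg r n (\<lambda>z. c * F z) = (\<lambda>z. c * torus_avg r n F z)"
    using Suc by auto
  then show ?case by (simp add: circle_avg_scale)
qed simp

lemma torus_avg_add:
  assumes "continuous_on (torus r N) F" "continuous_on (torus r N) G"
    and "0 \<le> r" "n \<le> N" "z \<in> torus r N"
  shows "torus_avg r n (\<lambda>z. F z + G z) z = torus_avg r n F z + torus_avg r n G z"
  using assms(4,5)
proof (induction n arbitrary: z)
  case (Suc n)
  then have "torus_avg r (Suc n) (\<lambda>z. F z + G z) z
      = circle_avg r (Suc n) (\<lambda>z. torus_avg r n F z + torus_avg r n G z) z"
    using assms by (auto intro!: circle_avg_cong)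
  also have "\<dots> = torus_avg r (Suc n) F z + torus_avg r (Suc n) G z"
    using Suc assms by (auto intro!: circle_avg_add continuous_on_torus_avg)
  finally show ?case .
qed simp

lemma torus_avg_zero: "torus_avg r n (\<lambda>_. 0) z = 0"
  using torus_avg_scale[of r n 0 "\<lambda>_. 0" z] by simp

lemma torus_avg_diff:
  assumes "continuous_on (torus r N) F" "continuous_on (torus r N) G"
    and "0 \<le> r" "n \<le> N" "z \<in> torus r N"
  shows "torus_avg r n (\<lambda>z. F z - G z) z = torus_avg r n F z - torus_avg r n G z"
  using torus_avg_add[OF assms(1) _ assms(3-5), of "\<lambda>z. (-1) * G z"] assms(2)
  by (simp only: torus_avg_scale) (auto intro: continuous_intros)

lemma torus_avg_sum:
  assumes "finite S" "\<And>s. s \<in> S \<Longrightarrow> continuous_on (torus r N) (F s)"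
    and "0 \<le> r" "n \<le> N" "z \<in> torus r N"
  shows "torus_avg r n (\<lambda>z. \<Sum>s\<in>S. F s z) z = (\<Sum>s\<in>S. torus_avg r n (F s) z)"
  using assms(1,2)
proof (induction S)
  case (insert x S)
  then show ?case
    using torus_avg_add[OF insert.prems continuous_on_sum[OF insert.prems] assms(3-5), of x S "\<lambda>s. s"]
    by simp
qed (simp add: torus_avg_zero)

lemma circle_avg_bound:
  assumes "continuous_on (torus r N) F" "\<And>z. z \<in> torus r N \<Longrightarrow> norm (F z) \<le> B"
    and "0 \<le> r" "k \<in> {1..N}" "z \<in> torus r N"
  shows "norm (circle_avg r k F z) \<le> B"
proof -
  have "norm (integral {0..2*pi} (\<lambda>\<theta>. F (z(k := of_real r * cis \<theta>)))) \<le> B * (2 * pi - 0)"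
    by (rule integral_bound) (use assms(2)[OF torus_update_cis[OF assms(3,5,4)]] continuous_on_circle[OF assms(1,3,5,4)] in auto)
  then show ?thesis
    by (simp add: circle_avg_def norm_divide norm_mult field_simps)
qed

lemma torus_avg_bound:
  assumes "continuous_on (torus r N) F" "\<And>z. z \<in> torus r N \<Longrightarrow> norm (F z) \<le> B"
    and "0 \<le> r" "n \<le> N" "z \<in> torus r N"
  shows "norm (torus_avg r n F z) \<le> B"
  using assms(4,5)
  by (induction n arbitrary: z)
     (use assms in \<open>auto intro!: circle_avg_bound[where N=N] continuous_on_torus_avg\<close>)

lemma circle_avg_commute:
  assumes "continuous_on (torus r N) F" "0 \<le> r" "k \<in> {1..N}" "l \<in> {1..N}" "z \<in> torus r N"
  shows "circle_avg r k (circle_avg r l F) z = circle_avg r l (circle_avg r k F) z"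
proof (cases "k = l")
  case False
  let ?f = "\<lambda>s t. F (z(k := of_real r * cis s, l := of_real r * cis t))"
  have "continuous_on (cbox (0, 0) (2*pi, 2*pi)) (\<lambda>(s, t). ?f s t)"
    unfolding case_prod_beta
    by (rule continuous_on_compose2[OF assms(1)])
       (use assms in \<open>auto intro!: continuous_on_circle_update continuous_on_fst continuous_on_snd continuous_on_id continuous_on_const torus_update_cis\<close>)
  from integral_swap_continuous[OF this] show ?thesis
    using False by (simp add: circle_avg_def fun_upd_twist)
qed simp

lemma circle_avg_torus_avg_commute:
  assumes "continuous_on (torus r N) F" "0 \<le> r" "k \<in> {1..N}" "n \<le> N" "z \<in> torus r N"
  shows "circle_avg r k (torus_avg r n F) z = torus_avg r n (circle_avg r k F) z"
  using assms(4,5)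
proof (induction n arbitrary: z)
  case (Suc n)
  then have "circle_avg r k (torus_avg r (Suc n) F) z
      = circle_avg r (Suc n) (circle_avg r k (torus_avg r n F)) z"
    using assms by (auto intro!: circle_avg_commute continuous_on_torus_avg)
  also have "\<dots> = torus_avg r (Suc n) (circle_avg r k F) z"
    using assms Suc by (auto intro!: circle_avg_cong)
  finally show ?case .
qed simp

lemma torus_avg_local:
  assumes "\<And>i. i \<notin> {1..n} \<Longrightarrow> z i = z' i"
  shows "torus_avg r n F z = torus_avg r n F z'"
  using assms
proof (induction n arbitrary: z z')
  case 0
  then have "z = z'" by auto
  then show ?case by simp
next
  case (Suc n)
  have "torus_avg r n F (z(Suc n := w)) = torus_avg r n F (z'(Suc n := w))" for w
    by (rule Suc.IH) (use Suc.prems in auto)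
  then show ?case by (simp add: circle_avg_def)
qed

text \<open>Any chosen variable may be integrated first. The full average is constant in coordinate
  \<open>k\<close>, so one more average over it changes nothing, and Fubini moves that average to
  the innermost place.\<close>

lemma circle_avg_torus_avg:
  assumes "continuous_on (torus r N) F" "0 \<le> r" "k \<in> {1..N}" "z \<in> torus r N"
  shows "torus_avg r N F z = torus_avg r N (circle_avg r k F) z"
proof -
  have "circle_avg r k (torus_avg r N F) z = torus_avg r N F z"
    by (rule circle_avg_const, rule torus_avg_local) (use assms in auto)
  then show ?thesis
    using circle_avg_torus_avg_commute[OF assms(1-3) order.refl assms(4)] by simp
qed

lemma torus_avg_eq_0I:
  assumes "continuous_on (torus r N) F" "0 \<le> r" "k \<in> {1..N}" "z \<in> torus r N"
    and "\<And>z. z \<in> torus r N \<Longrightarrow> circle_avg r k F z = 0"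
  shows "torus_avg r N F z = 0"
  using circle_avg_torus_avg[OF assms(1-4)]
    torus_avg_cong[of r N "circle_avg r k F" "\<lambda>_. 0" N z] assms
  by (simp add: torus_avg_zero)

lemma circle_avg_perm:
  assumes "bij s"
  shows "circle_avg r k (\<lambda>z. F (z \<circ> s)) z = circle_avg r (inv s k) F (z \<circ> s)"
proof -
  have "(z(k := w)) \<circ> s = (z \<circ> s)(inv s k := w)" for w
    using assms by (auto simp: fun_eq_iff bij_inv_eq_iff)
  then show ?thesis by (simp add: circle_avg_def)
qed

text \<open>The comparison fails at \<open>n = k\<close>, where only one of the two exchanged
  variables has been averaged. It is therefore proved for \<open>n < k\<close> and for
  \<open>n > k\<close> separately; the second induction starts at \<open>n = k + 1\<close>, where
  both variables have been averaged, in opposite orders on the two sides, and Fubini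
  applies.\<close>

lemma torus_avg_swap:
  assumes "continuous_on (torus r N) F" "0 \<le> r" "1 \<le> k" "k < N"
  shows "torus_avg r N (\<lambda>z. F (z \<circ> Transposition.transpose k (Suc k))) (torus_base r N)
    = torus_avg r N F (torus_base r N)"
proof -
  let ?s = "Transposition.transpose k (Suc k)"
  let ?G = "\<lambda>z. F (z \<circ> ?s)"
  have [simp]: "inv ?s = ?s" by (rule inv_transpose_eq)
  have avg: "circle_avg r j (\<lambda>z. H (z \<circ> ?s)) z = circle_avg r (?s j) H (z \<circ> ?s)" for j H z
    using circle_avg_perm[of ?s r j H z] by simp
  have lo: "torus_avg r n ?G z = torus_avg r n F (z \<circ> ?s)" if "n < k" for n z
    using that
  proof (induction n arbitrary: z)
    case (Suc n)
    then have "torus_avg r n ?G = (\<lambda>z. torus_avg r n F (z \<circ> ?s))"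
      by (intro ext Suc.IH) auto
    moreover have "?s (Suc n) = Suc n"
      using Suc by (auto simp: Transposition.transpose_def)
    ultimately show ?case by (simp only: torus_avg.simps avg)
  qed simp
  have mem: "z \<circ> ?s \<in> torus r N" if "z \<in> torus r N" for z
    by (rule torus_transpose[OF assms(3,4) that])
  have hi: "torus_avg r n ?G z = torus_avg r n F (z \<circ> ?s)"
    if "k < n" "n \<le> N" "z \<in> torus r N" for n z
    using that
  proof (induction n arbitrary: z)
    case (Suc n)
    show ?case
    proof (cases "n = k")
      case True
      obtain m where m: "k = Suc m" using assms by (cases k) auto
      have "torus_avg r m ?G = (\<lambda>z. torus_avg r m F (z \<circ> ?s))"
        using lo m by auto
      moreover have "circle_avg r k (\<lambda>z. torus_avg r m F (z \<circ> ?s))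
          = (\<lambda>z. circle_avg r (Suc k) (torus_avg r m F) (z \<circ> ?s))"
        by (intro ext) (simp only: avg transpose_apply_first)
      moreover have "torus_avg r (Suc n) ?G z = circle_avg r (Suc k) (circle_avg r k (torus_avg r m ?G)) z"
        by (simp only: True m torus_avg.simps)
      ultimately have "torus_avg r (Suc n) ?G z
          = circle_avg r (Suc k) (\<lambda>z. circle_avg r (Suc k) (torus_avg r m F) (z \<circ> ?s)) z"
        by (simp only:)
      also have "\<dots> = circle_avg r k (circle_avg r (Suc k) (torus_avg r m F)) (z \<circ> ?s)"
        by (simp add: avg)
      also have "\<dots> = circle_avg r (Suc k) (circle_avg r k (torus_avg r m F)) (z \<circ> ?s)"
        using assms Suc.prems m mem[OF Suc.prems(3)]
        by (intro circle_avg_commute[where N=N]) (auto intro!: continuous_on_torus_avg)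
      finally show ?thesis by (simp only: True m torus_avg.simps)
    next
      case False
      then have "k < n" using Suc.prems by auto
      have "torus_avg r (Suc n) ?G z
          = circle_avg r (Suc n) (\<lambda>z. torus_avg r n F (z \<circ> ?s)) z"
        unfolding torus_avg.simps
      proof (rule circle_avg_cong[where N=N])
        show "torus_avg r n ?G z = torus_avg r n F (z \<circ> ?s)" if "z \<in> torus r N" for z
          by (rule Suc.IH) (use \<open>k < n\<close> Suc.prems that in auto)
      qed (use assms Suc.prems in auto)
      moreover have "?s (Suc n) = Suc n"
        using \<open>k < n\<close> by (auto simp: Transposition.transpose_def)
      ultimately show ?thesis by (simp only: torus_avg.simps avg)
    qed
  qed simp
  have "torus_base r N \<circ> ?s = torus_base r N"
    using assms by (auto simp: torus_base_def Transposition.transpose_def fun_eq_iff)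
  then show ?thesis
    using hi[of N "torus_base r N"] assms torus_base_in_torus by simp
qed

section \<open>From iterated contour integrals to torus averages\<close>

lemma torus_avg_update:
  assumes "n < k"
  shows "torus_avg r n (\<lambda>z. F (z(k := w))) z = torus_avg r n F (z(k := w))"
  using assms
proof (induction n arbitrary: z)
  case (Suc n)
  then have "torus_avg r n (\<lambda>z. F (z(k := w))) = (\<lambda>z. torus_avg r n F (z(k := w)))"
    by (intro ext Suc.IH) auto
  moreover have "z(Suc n := v, k := w) = z(k := w, Suc n := v)" for v
    using Suc.prems by auto
  ultimately show ?case by (simp only: torus_avg.simps circle_avg_def)
qed simp

text \<open>Each variable contributes dz = i z d\<theta>: a factor 2 pi i from the normalisation and
  a factor \<open>z i\<close> in the integrand. The two recursions differ in that one substitutes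
  the outer variable into the integrand and the other into the evaluation point;
  \<open>torus_avg_update\<close> reconciles them.\<close>

lemma multi_circle_integral_eq:
  "multi_circle_integral r n F
    = (2 * of_real pi * \<i>) ^ n * torus_avg r n (\<lambda>z. F z * (\<Prod>i=1..n. z i)) (\<lambda>_. 0)"
proof (induction n arbitrary: F)
  case (Suc n)
  let ?H = "\<lambda>z. F z * (\<Prod>i=1..n. z i)"
  let ?G = "\<lambda>z. F z * (\<Prod>i=1..Suc n. z i)"
  have upd: "multi_circle_integral r n (\<lambda>zs. F (zs(Suc n := w)))
      = (2 * of_real pi * \<i>) ^ n * torus_avg r n ?H ((\<lambda>_. 0)(Suc n := w))" for w
  proof -
    have "(\<lambda>z. F (z(Suc n := w)) * (\<Prod>i=1..n. z i)) = (\<lambda>z. ?H (z(Suc n := w)))"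
      by (auto intro!: prod.cong)
    moreover have "torus_avg r n (\<lambda>z. ?H (z(Suc n := w))) (\<lambda>_. 0)
        = torus_avg r n ?H ((\<lambda>_. 0)(Suc n := w))"
      by (rule torus_avg_update) simp
    ultimately show ?thesis
      by (simp only: Suc.IH)
  qed
  have G: "torus_avg r n ?G ((\<lambda>_. 0)(Suc n := w)) = w * torus_avg r n ?H ((\<lambda>_. 0)(Suc n := w))" for w
  proof -
    have "torus_avg r n ?G ((\<lambda>_. 0)(Suc n := w)) = torus_avg r n (\<lambda>z. ?G (z(Suc n := w))) (\<lambda>_. 0)"
      by (rule torus_avg_update[symmetric]) simp
    also have "(\<lambda>z. ?G (z(Suc n := w))) = (\<lambda>z. w * ?H (z(Suc n := w)))"
      by (auto simp: fun_eq_iff intro!: prod.cong)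
    also have "torus_avg r n \<dots> (\<lambda>_. 0) = w * torus_avg r n (\<lambda>z. ?H (z(Suc n := w))) (\<lambda>_. 0)"
      by (rule torus_avg_scale)
    also have "torus_avg r n (\<lambda>z. ?H (z(Suc n := w))) (\<lambda>_. 0)
        = torus_avg r n ?H ((\<lambda>_. 0)(Suc n := w))"
      by (rule torus_avg_update) simp
    finally show ?thesis .
  qed
  have "multi_circle_integral r (Suc n) F = integral {0..2*pi} (\<lambda>\<theta>. (2 * of_real pi * \<i>) ^ n * \<i> *
      torus_avg r n ?G ((\<lambda>_. 0)(Suc n := of_real r * cis \<theta>)))"
    unfolding multi_circle_integral.simps circle_integral_def upd G
    by (simp add: algebra_simps)
  also have "\<dots> = (2 * of_real pi * \<i>) ^ n * \<i> * integral {0..2*pi} (\<lambda>\<theta>.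
      torus_avg r n ?G ((\<lambda>_. 0)(Suc n := of_real r * cis \<theta>)))"
    by (rule integral_mult_right)
  also have "\<dots> = (2 * of_real pi * \<i>) ^ Suc n * torus_avg r (Suc n) ?G (\<lambda>_. 0)"
    by (simp add: circle_avg_def)
  finally show ?case .
qed simp

corollary multi_circle_integral_eq_base:
  "(1 / (2 * of_real pi * \<i>)) ^ n * multi_circle_integral r n F
    = torus_avg r n (\<lambda>z. F z * (\<Prod>i=1..n. z i)) (torus_base r n)"
proof -
  have "torus_avg r n (\<lambda>z. F z * (\<Prod>i=1..n. z i)) (\<lambda>_. 0)
      = torus_avg r n (\<lambda>z. F z * (\<Prod>i=1..n. z i)) (torus_base r n)"
    by (rule torus_avg_local) (auto simp: torus_base_def)
  then show ?thesis
    by (simp add: multi_circle_integral_eq power_divide)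
qed

section \<open>Mean values inside and outside a circle\<close>

lemma circle_mean_value:
  assumes "continuous_on (cball 0 r) f" "f holomorphic_on ball 0 r" "0 < r"
  shows "((\<lambda>\<theta>. f (of_real r * cis \<theta>)) has_integral 2 * of_real pi * f 0) {0..2*pi}"
proof -
  have "((\<lambda>u. f u / (u - 0)) has_contour_integral (2 * of_real pi * \<i> * f 0)) (circlepath 0 r)"
    by (rule Cauchy_integral_circlepath) (use assms in auto)
  then have "((\<lambda>\<theta>. f (of_real r * cis \<theta>) / (of_real r * cis \<theta>) * r * \<i> * cis \<theta>)
      has_integral (2 * of_real pi * \<i> * f 0)) {0..2*pi}"
    unfolding circlepath_def by (subst (asm) has_contour_integral_part_circlepath_iff) auto
  moreover have "f (of_real r * cis \<theta>) / (of_real r * cis \<theta>) * r * \<i> * cis \<theta>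
      = \<i> * f (of_real r * cis \<theta>)" for \<theta>
    using assms(3) by (simp add: field_simps)
  ultimately have "((\<lambda>\<theta>. \<i> * f (of_real r * cis \<theta>)) has_integral (2 * of_real pi * \<i> * f 0)) {0..2*pi}"
    by (simp only:)
  from has_integral_mult_right[OF this, of "- \<i>"]
  have "((\<lambda>\<theta>. - \<i> * (\<i> * f (of_real r * cis \<theta>))) has_integral
      - \<i> * (2 * of_real pi * \<i> * f 0)) {0..2*pi}" .
  moreover have "- \<i> * (2 * of_real pi * \<i> * f 0) = 2 * of_real pi * f 0"
    by (simp add: complex_eq_iff)
  moreover have "- \<i> * (\<i> * x) = x" for x
    by (simp add: complex_eq_iff)
  ultimately show ?thesis
    by (simp only:)
qed

lemma circle_avg_mean_value:
  assumes "continuous_on (cball 0 r) (\<lambda>w. F (z(k := w)))" "(\<lambda>w. F (z(k := w))) holomorphic_on ball 0 r"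
    and "0 < r"
  shows "circle_avg r k F z = F (z(k := 0))"
  using integral_unique[OF circle_mean_value[OF assms]] by (simp add: circle_avg_def)

text \<open>The map w to r^2 / w exchanges the inside and the outside of the circle and acts on the
  circle itself as complex conjugation, which preserves averages. Hence \<open>g\<close> is the
  integrand seen from outside, and \<open>g 0\<close> is its value at infinity.\<close>

lemma circle_avg_mean_value_outside:
  assumes "continuous_on (cball 0 r) g" "g holomorphic_on ball 0 r" "0 < r"
    and "\<And>w. norm w = r \<Longrightarrow> F (z(k := of_real (r\<^sup>2) / w)) = g w"
  shows "circle_avg r k F z = g 0"
proof -
  have eq: "F (z(k := of_real r * cis (- \<theta>))) = g (of_real r * cis \<theta>)" for \<theta>
  proof -
    have "of_real (r\<^sup>2) / (of_real r * cis \<theta>) = of_real r * cis (- \<theta>)"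
      using assms(3) by (simp add: cis_inverse[symmetric] power2_eq_square field_simps)
    then show ?thesis
      using assms(4)[of "of_real r * cis \<theta>"] assms(3) by (simp add: norm_mult)
  qed
  \<comment> \<open>Conjugation reverses the angle; using 2 pi - \<theta> instead of - \<theta> maps
    the interval of integration onto itself.\<close>
  have per: "cis (2*pi - \<theta>) = cis (- \<theta>)" for \<theta>
    by (simp add: complex_eq_iff cos_diff sin_diff)
  have "((\<lambda>\<theta>. g (of_real r * cis \<theta>)) has_integral 2 * of_real pi * g 0) (cbox 0 (2*pi))"
    using circle_mean_value[OF assms(1-3)] by simp
  from has_integral_affinity[OF this, of "-1" "2*pi"]
  have "((\<lambda>\<theta>. g (of_real r * cis (2*pi - \<theta>))) has_integral 2 * of_real pi * g 0)
      ((\<lambda>x. 2*pi - x) ` {0..2*pi})"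
    by simp
  moreover have "(\<lambda>x. 2*pi - x) ` {0..2*pi} = {0..2*pi}"
    by simp
  moreover have "g (of_real r * cis (2*pi - \<theta>)) = F (z(k := of_real r * cis \<theta>))" for \<theta>
    using eq[of "- \<theta>"] by (simp add: per)
  ultimately have "((\<lambda>\<theta>. F (z(k := of_real r * cis \<theta>))) has_integral 2 * of_real pi * g 0) {0..2*pi}"
    by simp
  from integral_unique[OF this] show ?thesis
    by (simp add: circle_avg_def)
qed

text \<open>On the compact torus \<open>F\<close> and \<open>t * G\<close> are bounded, so the
  exponential series converges uniformly by the M-test and can be averaged term by term.\<close>

lemma torus_avg_exp_series:
  assumes "continuous_on (torus r N) F" "continuous_on (torus r N) G" "0 \<le> r" "z \<in> torus r N"
  shows "(\<lambda>n. t ^ n / fact n * torus_avg r N (\<lambda>z. F z * G z ^ n) z) sums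
    torus_avg r N (\<lambda>z. F z * exp (t * G z)) z"
proof -
  let ?f = "\<lambda>n z. F z * (t * G z) ^ n / fact n"
  obtain B where B: "\<And>z. z \<in> torus r N \<Longrightarrow> norm (F z) \<le> B"
    using compact_imp_bounded[OF compact_continuous_image[OF assms(1) compact_torus]]
    unfolding bounded_iff by auto
  obtain C where C: "\<And>z. z \<in> torus r N \<Longrightarrow> norm (t * G z) \<le> C"
    using compact_imp_bounded[OF compact_continuous_image[OF
      continuous_on_mult_left[OF assms(2), of t] compact_torus]]
    unfolding bounded_iff by auto
  have "0 \<le> B" using B[OF assms(4)] norm_ge_zero order_trans by blast
  have contf: "continuous_on (torus r N) (?f n)" for n
    by (intro continuous_intros assms) auto
  have conte: "continuous_on (torus r N) (\<lambda>z. F z * exp (t * G z))"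
    by (intro continuous_intros assms)
  have lim: "uniform_limit (torus r N) (\<lambda>n x. \<Sum>i<n. ?f i x) (\<lambda>x. suminf (\<lambda>i. ?f i x)) sequentially"
  proof (rule Weierstrass_m_test)
    show "norm (?f n z) \<le> B * (C ^ n / fact n)" if "z \<in> torus r N" for n z
    proof -
      have "norm (F z) * norm (t * G z) ^ n \<le> B * C ^ n"
        using B[OF that] C[OF that] \<open>0 \<le> B\<close> by (intro mult_mono power_mono) auto
      then show ?thesis
        by (simp add: norm_mult norm_divide norm_power divide_right_mono)
    qed
    show "summable (\<lambda>n. B * (C ^ n / fact n))"
      using summable_exp[of C] by (intro summable_mult) (simp add: divide_inverse mult.commute)
  qed
  have "suminf (\<lambda>i. ?f i x) = F x * exp (t * G x)" for x
  proof -
    have "(\<lambda>n. F x * ((t * G x) ^ n /\<^sub>R fact n)) sums (F x * exp (t * G x))"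
      by (intro sums_mult exp_converges)
    then show ?thesis
      by (simp add: sums_iff scaleR_conv_of_real field_simps)
  qed
  then have lim: "uniform_limit (torus r N) (\<lambda>n x. \<Sum>i<n. ?f i x) (\<lambda>x. F x * exp (t * G x)) sequentially"
    using lim by simp
  have "(\<lambda>n. torus_avg r N (\<lambda>z. \<Sum>i<n. ?f i z) z) \<longlonglongrightarrow> torus_avg r N (\<lambda>z. F z * exp (t * G z)) z"
  proof (rule tendstoI)
    fix e :: real assume "e > 0"
    then have "\<forall>\<^sub>F n in sequentially. \<forall>x\<in>torus r N. dist (\<Sum>i<n. ?f i x) (F x * exp (t * G x)) < e / 2"
      using lim unfolding uniform_limit_iff by (meson half_gt_zero)
    then show "\<forall>\<^sub>F n in sequentially. dist (torus_avg r N (\<lambda>z. \<Sum>i<n. ?f i z) z)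
        (torus_avg r N (\<lambda>z. F z * exp (t * G z)) z) < e"
    proof eventually_elim
      case (elim n)
      have "norm (torus_avg r N (\<lambda>z. (\<Sum>i<n. ?f i z) - F z * exp (t * G z)) z) \<le> e / 2"
        by (rule torus_avg_bound[where N=N])
           (use elim assms in \<open>auto intro!: continuous_on_diff continuous_on_sum contf conte simp: dist_norm less_imp_le\<close>)
      then show ?case
        using \<open>e > 0\<close> assms contf conte
        by (subst (asm) torus_avg_diff[where N=N])
           (auto intro!: continuous_on_sum simp: dist_norm)
    qed
  qed
  moreover have "torus_avg r N (\<lambda>z. \<Sum>i<n. ?f i z) z
      = (\<Sum>i<n. t ^ i / fact i * torus_avg r N (\<lambda>z. F z * G z ^ i) z)" for n
  proof -
    have "torus_avg r N (?f i) z = t ^ i / fact i * torus_avg r N (\<lambda>z. F z * G z ^ i) z" for i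
      by (subst torus_avg_scale[symmetric]) (simp add: power_mult_distrib mult_ac)
    then show ?thesis
      by (subst torus_avg_sum[where N=N]) (use assms contf in auto)
  qed
  ultimately show ?thesis unfolding sums_def by simp
qed

section \<open>The backward equation\<close>

text \<open>Divided by u v this equals epsilon(v) - q epsilon(u), the symbol of the boundary
  relation between neighbouring particles on one site. This is the origin of the scattering
  factor.\<close>

definition Dfac :: "real \<Rightarrow> complex \<Rightarrow> complex \<Rightarrow> complex" where
  "Dfac q u v = u - of_real q * v - (1 - of_real q) * u * v"

lemma Sfac_eq: "Sfac q z \<beta> \<alpha> = - Dfac q (z \<beta>) (z \<alpha>) / Dfac q (z \<alpha>) (z \<beta>)"
  by (simp add: Sfac_def Dfac_def mult_ac)

lemma finite_inversions: "finite (inversions N \<sigma>)"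
  by (rule finite_subset[of _ "{1..N} \<times> {1..N}"]) (auto simp: inversions_def)

text \<open>The part of the integrand that depends on \<sigma>. After reindexing by \<sigma>, the
  factors carrying \<open>Y\<close> and the time are the same for all permutations and are split off
  as \<open>monom_inv\<close> and \<open>energy\<close>.\<close>

definition bethe_term :: "nat \<Rightarrow> real \<Rightarrow> (nat \<Rightarrow> int) \<Rightarrow> (nat \<Rightarrow> nat) \<Rightarrow> (nat \<Rightarrow> complex) \<Rightarrow> complex" where
  "bethe_term N q X \<sigma> z = Aperm N q \<sigma> z * (\<Prod>i=1..N. z (\<sigma> i) powi X i)"

definition bethe :: "nat \<Rightarrow> real \<Rightarrow> (nat \<Rightarrow> int) \<Rightarrow> (nat \<Rightarrow> complex) \<Rightarrow> complex" where
  "bethe N q X z = (\<Sum>\<sigma>\<in>{\<sigma>. \<sigma> permutes {1..N}}. bethe_term N q X \<sigma> z)"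

definition monom_inv :: "nat \<Rightarrow> (nat \<Rightarrow> int) \<Rightarrow> (nat \<Rightarrow> complex) \<Rightarrow> complex" where
  "monom_inv N Y z = (\<Prod>j=1..N. z j powi (- Y j))"

definition energy :: "nat \<Rightarrow> (nat \<Rightarrow> complex) \<Rightarrow> complex" where
  "energy N z = (\<Sum>i=1..N. epsilon (z i))"

text \<open>The transposition preserves the order of every increasing pair except (k, k+1). So the
  inversions of \<open>s \<circ> \<sigma>\<close> are the images under \<open>s\<close> of those of
  \<sigma>, together with the new pair (k, k+1), which is no inversion of \<sigma> by the assumption
  \<open>lt\<close>.\<close>

lemma bethe_term_transpose:
  assumes \<sigma>: "\<sigma> permutes {1..N}" and k: "1 \<le> k" "k < N" and lt: "inv \<sigma> k < inv \<sigma> (Suc k)"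
  defines "s \<equiv> Transposition.transpose k (Suc k)"
  shows "bethe_term N q X (s \<circ> \<sigma>) z = Sfac q z (Suc k) k * bethe_term N q X \<sigma> (z \<circ> s)"
proof -
  have inv: "inv (s \<circ> \<sigma>) = inv \<sigma> \<circ> s"
    using permutes_bij[OF \<sigma>] by (simp add: s_def o_inv_distrib)
  have sN: "s i \<in> {1..N} \<longleftrightarrow> i \<in> {1..N}" for i
    using k by (auto simp: s_def Transposition.transpose_def)
  have ss: "s (s i) = i" for i by (simp add: s_def)
  have sk: "s k = Suc k" "s (Suc k) = k" by (simp_all add: s_def)
  have mono: "s i < s j" if "i < j" "(i, j) \<noteq> (k, Suc k)" for i j
    using that by (auto simp: s_def Transposition.transpose_def)
  have nk: "(k, Suc k) \<notin> inversions N \<sigma>" using lt by (auto simp: inversions_def)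
  have eq: "inversions N (s \<circ> \<sigma>) = insert (k, Suc k) (map_prod s s ` inversions N \<sigma>)" (is "?L = ?R")
  proof
    show "?L \<subseteq> ?R"
    proof
      fix p assume "p \<in> ?L"
      then obtain a b where p: "p = (a, b)" and ab: "a \<in> {1..N}" "b \<in> {1..N}" "a < b"
          "inv \<sigma> (s b) < inv \<sigma> (s a)"
        by (auto simp: inversions_def inv)
      show "p \<in> ?R"
      proof (cases "(a, b) = (k, Suc k)")
        case False
        have "(s a, s b) \<in> inversions N \<sigma>"
          using ab mono[OF ab(3) False] sN[of a] sN[of b] unfolding inversions_def by blast
        then have "map_prod s s (s a, s b) \<in> map_prod s s ` inversions N \<sigma>" by blast
        then show ?thesis by (simp add: ss p)
      qed (use p in simp)
    qed
    show "?R \<subseteq> ?L"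
    proof
      fix p assume "p \<in> ?R"
      then consider "p = (k, Suc k)" | a b where "p = (s a, s b)" "(a, b) \<in> inversions N \<sigma>" by auto
      then show "p \<in> ?L"
      proof cases
        case 1
        then show ?thesis using k lt by (auto simp: inversions_def inv sk)
      next
        case 2
        then have "(a, b) \<noteq> (k, Suc k)" using nk by auto
        then have "s a < s b" using 2 mono[of a b] by (auto simp: inversions_def)
        moreover have "s a \<in> {1..N}" "s b \<in> {1..N}" "inv \<sigma> (s (s b)) < inv \<sigma> (s (s a))"
          using 2 sN[of a] sN[of b] by (auto simp: inversions_def ss)
        ultimately show ?thesis unfolding inversions_def inv 2 by simp
      qed
    qed
  qed
  have inj: "inj_on (map_prod s s) A" for A
    by (rule inj_on_inverseI[where g = "map_prod s s"]) (auto simp: ss)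
  have nin: "(k, Suc k) \<notin> map_prod s s ` inversions N \<sigma>"
  proof
    assume "(k, Suc k) \<in> map_prod s s ` inversions N \<sigma>"
    then obtain a b where ab: "k = s a" "Suc k = s b" "(a, b) \<in> inversions N \<sigma>" by auto
    then have "a = Suc k" "b = k" using ss[of a] ss[of b] sk by simp_all
    then show False using ab by (auto simp: inversions_def)
  qed
  have "Aperm N q (s \<circ> \<sigma>) z = Sfac q z (Suc k) k *
      (\<Prod>p\<in>map_prod s s ` inversions N \<sigma>. case p of (\<alpha>, \<beta>) \<Rightarrow> Sfac q z \<beta> \<alpha>)"
    unfolding Aperm_def eq by (subst prod.insert) (use nin finite_inversions in auto)
  also have "(\<Prod>p\<in>map_prod s s ` inversions N \<sigma>. case p of (\<alpha>, \<beta>) \<Rightarrow> Sfac q z \<beta> \<alpha>)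
      = Aperm N q \<sigma> (z \<circ> s)"
    unfolding Aperm_def by (subst prod.reindex[OF inj]) (auto simp: Sfac_def intro!: prod.cong)
  finally have A: "Aperm N q (s \<circ> \<sigma>) z = Sfac q z (Suc k) k * Aperm N q \<sigma> (z \<circ> s)" .
  have "(\<Prod>i=1..N. z ((s \<circ> \<sigma>) i) powi X i) = (\<Prod>i=1..N. (z \<circ> s) (\<sigma> i) powi X i)"
    by simp
  then show ?thesis
    unfolding bethe_term_def A by (simp only: mult.assoc)
qed

text \<open>Left multiplication by the transposition pairs off the permutations; each pair is
  represented by the member in which k comes before k+1.\<close>

lemma bethe_split:
  assumes k: "1 \<le> k" "k < N"
  defines "s \<equiv> Transposition.transpose k (Suc k)"
  shows "bethe N q X z = (\<Sum>\<sigma> | \<sigma> permutes {1..N} \<and> inv \<sigma> k < inv \<sigma> (Suc k).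
      bethe_term N q X \<sigma> z + Sfac q z (Suc k) k * bethe_term N q X \<sigma> (z \<circ> s))"
proof -
  let ?P = "{\<sigma>. \<sigma> permutes {1..N}}"
  let ?T = "{\<sigma>. \<sigma> permutes {1..N} \<and> inv \<sigma> k < inv \<sigma> (Suc k)}"
  have s: "s permutes {1..N}"
    unfolding s_def by (rule permutes_swap_id) (use k in auto)
  have ss: "s \<circ> (s \<circ> \<sigma>) = \<sigma>" for \<sigma> :: "nat \<Rightarrow> nat"
    by (rule ext) (simp add: s_def)
  have inv: "inv (s \<circ> \<sigma>) = inv \<sigma> \<circ> s" if "\<sigma> permutes {1..N}" for \<sigma>
    using permutes_bij[OF that] by (simp add: s_def o_inv_distrib)
  have sk: "s k = Suc k" "s (Suc k) = k" by (simp_all add: s_def)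
  have neq: "inv \<sigma> k \<noteq> inv \<sigma> (Suc k)" if "\<sigma> permutes {1..N}" for \<sigma>
    using inj_eq[OF permutes_inj[OF permutes_inv[OF that]]] by simp
  have img: "?P - ?T = (\<lambda>\<sigma>. s \<circ> \<sigma>) ` ?T"
  proof (intro equalityI subsetI)
    fix \<sigma> assume "\<sigma> \<in> ?P - ?T"
    then have \<sigma>: "\<sigma> permutes {1..N}" "inv \<sigma> (Suc k) < inv \<sigma> k"
      using neq[of \<sigma>] by auto
    then have "s \<circ> \<sigma> \<in> ?T"
      using permutes_compose[OF \<sigma>(1) s] by (simp add: inv sk)
    then show "\<sigma> \<in> (\<lambda>\<sigma>. s \<circ> \<sigma>) ` ?T"
      by (rule rev_image_eqI) (rule ss[symmetric])
  next
    fix \<sigma> assume "\<sigma> \<in> (\<lambda>\<sigma>. s \<circ> \<sigma>) ` ?T"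
    then obtain \<tau> where \<tau>: "\<sigma> = s \<circ> \<tau>" "\<tau> permutes {1..N}" "inv \<tau> k < inv \<tau> (Suc k)" by blast
    then show "\<sigma> \<in> ?P - ?T"
      using permutes_compose[OF \<tau>(2) s] by (simp add: inv sk)
  qed
  have inj: "inj_on (\<lambda>\<sigma>. s \<circ> \<sigma>) ?T"
    by (rule inj_on_inverseI[where g = "\<lambda>\<sigma>. s \<circ> \<sigma>"]) (rule ss)
  have fin: "finite ?P" by (simp add: finite_permutations)
  have "bethe N q X z = (\<Sum>\<sigma>\<in>?P - ?T. bethe_term N q X \<sigma> z) + (\<Sum>\<sigma>\<in>?T. bethe_term N q X \<sigma> z)"
    unfolding bethe_def by (rule sum.subset_diff) (use fin in auto)
  also have "(\<Sum>\<sigma>\<in>?P - ?T. bethe_term N q X \<sigma> z) = (\<Sum>\<sigma>\<in>?T. bethe_term N q X (s \<circ> \<sigma>) z)"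
    unfolding img by (subst sum.reindex[OF inj]) simp
  also have "\<dots> = (\<Sum>\<sigma>\<in>?T. Sfac q z (Suc k) k * bethe_term N q X \<sigma> (z \<circ> s))"
    by (rule sum.cong[OF refl]) (use bethe_term_transpose[OF _ k] s_def in blast)
  finally show ?thesis by (simp add: sum.distrib)
qed

lemma permute_monom_inv:
  assumes "s permutes {1..N}" "\<And>j. j \<in> {1..N} \<Longrightarrow> Y (s j) = Y j"
  shows "monom_inv N Y (z \<circ> s) = monom_inv N Y z"
proof -
  have "monom_inv N Y z = (\<Prod>j=1..N. z (s j) powi (- Y (s j)))"
    unfolding monom_inv_def by (rule prod.permute[OF assms(1), unfolded o_def])
  also have "\<dots> = monom_inv N Y (z \<circ> s)"
    unfolding monom_inv_def by (rule prod.cong) (use assms(2) in auto)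
  finally show ?thesis by simp
qed

lemma permute_energy:
  assumes "s permutes {1..N}"
  shows "energy N (z \<circ> s) = energy N z"
  unfolding energy_def using sum.permute[OF assms, of "\<lambda>i. epsilon (z i)"] by (simp add: o_def)

lemma monom_inv_update:
  assumes "k \<in> {1..N}" "z k \<noteq> 0"
  shows "monom_inv N (Y(k := Y k + 1)) z = monom_inv N Y z / z k"
proof -
  have "monom_inv N (Y(k := Y k + 1)) z = z k powi (- Y k - 1) * (\<Prod>j\<in>{1..N} - {k}. z j powi (- Y j))"
    unfolding monom_inv_def using assms by (subst prod.remove[of _ k]) (auto intro!: prod.cong)
  also have "z k powi (- Y k - 1) = z k powi (- Y k) / z k"
    using assms by (simp add: power_int_diff)
  also have "z k powi (- Y k) / z k * (\<Prod>j\<in>{1..N} - {k}. z j powi (- Y j)) = monom_inv N Y z / z k"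
    unfolding monom_inv_def using assms by (subst (2) prod.remove[of _ k]) auto
  finally show ?thesis .
qed

section \<open>Ordered configurations and their blocks\<close>

lemma confs_antimono:
  assumes "Y \<in> confs N" "1 \<le> i" "i \<le> j" "j \<le> N"
  shows "Y j \<le> Y i"
  using assms(3,4)
proof (induction j rule: dec_induct)
  case (step j)
  have "Y (Suc j) \<le> Y j" using assms step by (auto simp: confs_def)
  then show ?case using step by simp
qed simp

text \<open>The fibres of a monotone sequence are intervals, so the particles on a site carry
  consecutive labels, beginning with the one that jumps.\<close>

lemma confs_fiber:
  assumes "Y \<in> confs N" "x \<in> occupied N Y"
  obtains m where "m \<in> {1..N}" "Y m = x" "(LEAST j. 1 \<le> j \<and> j \<le> N \<and> Y j = x) = m"
    "{j \<in> {1..N}. Y j = x} = {m..<m + eta N Y x}"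
proof -
  let ?A = "{j \<in> {1..N}. Y j = x}"
  have fin: "finite ?A" and ne: "?A \<noteq> {}" using assms by (auto simp: occupied_def)
  define m M where "m = Min ?A" and "M = Max ?A"
  have m: "m \<in> {1..N}" "Y m = x" and M: "M \<in> {1..N}" "Y M = x"
    using Min_in[OF fin ne] Max_in[OF fin ne] unfolding m_def M_def by blast+
  have le: "m \<le> j" "j \<le> M" if "j \<in> {1..N}" "Y j = x" for j
    unfolding m_def M_def using that by (simp_all add: Min_le[OF fin] Max_ge[OF fin])
  have A: "?A = {m..M}"
  proof
    show "?A \<subseteq> {m..M}" using le by (simp add: subset_eq)
    show "{m..M} \<subseteq> ?A"
    proof
      fix j assume j: "j \<in> {m..M}"
      then have "Y j \<le> Y m" "Y M \<le> Y j"
        using confs_antimono[OF assms(1), of m j] confs_antimono[OF assms(1), of j M] m M by auto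
      then show "j \<in> ?A" using m M j by auto
    qed
  qed
  have "eta N Y x = Suc M - m" unfolding eta_def A by simp
  then have "m + eta N Y x = Suc M" using le(1)[OF M] by simp
  then have B: "?A = {m..<m + eta N Y x}" unfolding A by auto
  have "(LEAST j. 1 \<le> j \<and> j \<le> N \<and> Y j = x) = m"
    by (rule Least_equality) (use m le(1) in auto)
  from that[OF m this B] show thesis .
qed

text \<open>The jumping particle has the smallest label on its site, so all smaller labels sit
  strictly to the right, at \<open>x + 1\<close> or beyond, and the order survives.\<close>

lemma jump_in_confs:
  assumes "Y \<in> confs N" "x \<in> occupied N Y"
  shows "jump N Y x \<in> confs N"
proof -
  obtain m where m: "m \<in> {1..N}" "Y m = x" "(LEAST j. 1 \<le> j \<and> j \<le> N \<and> Y j = x) = m"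
    and A: "{j \<in> {1..N}. Y j = x} = {m..<m + eta N Y x}"
    by (rule confs_fiber[OF assms])
  have gt: "Y j \<ge> x + 1" if "1 \<le> j" "j < m" for j
  proof -
    have "j \<notin> {j \<in> {1..N}. Y j = x}" unfolding A using that by auto
    then have "Y j \<noteq> x" using that m by auto
    moreover have "Y m \<le> Y j" using that m by (intro confs_antimono[OF assms(1)]) auto
    ultimately show ?thesis using m by auto
  qed
  have "(Y(m := x + 1)) (Suc j) \<le> (Y(m := x + 1)) j" if "1 \<le> j" "j < N" for j
  proof -
    have "Y (Suc j) \<le> Y j" using assms(1) that by (auto simp: confs_def)
    then show ?thesis using gt[of j] that m(2) by (cases "j = m"; cases "Suc j = m") auto
  qed
  then show ?thesis
    unfolding jump_def m(3) using assms(1) m(1) by (simp add: confs_def)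
qed

text \<open>Within a block of equal positions the increments form a geometric sequence, which turns the
  free generator into the one with rates \<open>[\<eta>]\<^sub>q\<close>.\<close>

lemma sum_blocks:
  fixes a :: "nat \<Rightarrow> complex"
  assumes Y: "Y \<in> confs N"
    and a: "\<And>k. 1 \<le> k \<Longrightarrow> k < N \<Longrightarrow> Y (Suc k) = Y k \<Longrightarrow> a (Suc k) = of_real q * a k"
  shows "(\<Sum>j=1..N. a j) = (\<Sum>x\<in>occupied N Y. of_real (qint q (eta N Y x)) *
    a (LEAST j. 1 \<le> j \<and> j \<le> N \<and> Y j = x))"
proof -
  have "(\<Sum>j=1..N. a j) = (\<Sum>x\<in>Y ` {1..N}. \<Sum>j | j \<in> {1..N} \<and> Y j = x. a j)"
    by (rule sum.image_gen) simp
  also have "\<dots> = (\<Sum>x\<in>occupied N Y. of_real (qint q (eta N Y x)) *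
    a (LEAST j. 1 \<le> j \<and> j \<le> N \<and> Y j = x))"
    unfolding occupied_def[symmetric]
  proof (rule sum.cong[OF refl])
    fix x assume x: "x \<in> occupied N Y"
    obtain m where m: "m \<in> {1..N}" "Y m = x" "(LEAST j. 1 \<le> j \<and> j \<le> N \<and> Y j = x) = m"
      and A: "{j \<in> {1..N}. Y j = x} = {m..<m + eta N Y x}"
      by (rule confs_fiber[OF Y x])
    have geo: "i < eta N Y x \<Longrightarrow> a (m + i) = of_real q ^ i * a m" for i
    proof (induction i)
      case (Suc i)
      then have "m + i \<in> {j \<in> {1..N}. Y j = x}" "m + Suc i \<in> {j \<in> {1..N}. Y j = x}"
        unfolding A by auto
      then show ?case using Suc a[of "m + i"] by auto
    qed simp
    have "(\<Sum>j | j \<in> {1..N} \<and> Y j = x. a j) = (\<Sum>i<eta N Y x. a (m + i))"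
      unfolding A by (rule sum.reindex_bij_witness[where i="\<lambda>i. m + i" and j="\<lambda>j. j - m"]) auto
    also have "\<dots> = of_real (qint q (eta N Y x)) * a m"
      by (simp add: geo qint_def sum_distrib_right)
    finally show "(\<Sum>j | j \<in> {1..N} \<and> Y j = x. a j) = of_real (qint q (eta N Y x)) *
        a (LEAST j. 1 \<le> j \<and> j \<le> N \<and> Y j = x)"
      unfolding m(3) .
  qed
  finally show ?thesis .
qed

section \<open>Contours of admissible radius and the boundary relation\<close>

locale qtazrp =
  fixes N :: nat and q r :: real
  assumes q0: "0 < \<bar>q\<bar>" and q1: "\<bar>q\<bar> < 1" and r0: "0 < r" and r1: "r < (1 - \<bar>q\<bar>) / \<bar>1 - q\<bar>"
begin

text \<open>The radius hypothesis cleared of its denominator, in the form in which all estimates use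
  it.\<close>

lemma radius_bound: "\<bar>q\<bar> + \<bar>1 - q\<bar> * r < 1"
  using q1 r1 by (simp add: field_simps)

text \<open>A zero would force |u| <= (|q| + |1-q| r) |v| < r. Only \<open>u\<close> has to be on
  the circle; leaving \<open>v\<close> free in the closed disc is what later permits moving
  \<open>v\<close> to 0.\<close>

lemma Dfac_nonzero:
  assumes "norm u = r" "norm v \<le> r"
  shows "Dfac q u v \<noteq> 0"
proof
  assume "Dfac q u v = 0"
  then have "u = of_real q * v + of_real (1 - q) * u * v"
    by (simp add: Dfac_def algebra_simps)
  then have "norm u \<le> norm (of_real q * v) + norm (of_real (1 - q) * u * v)"
    by (metis norm_triangle_ineq)
  also have "\<dots> = \<bar>q\<bar> * norm v + \<bar>1 - q\<bar> * r * norm v"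
    by (simp add: norm_mult assms del: of_real_diff)
  also have "\<dots> = (\<bar>q\<bar> + \<bar>1 - q\<bar> * r) * norm v"
    by (simp add: algebra_simps)
  also have "\<dots> \<le> (\<bar>q\<bar> + \<bar>1 - q\<bar> * r) * r"
    using assms r0 by (intro mult_left_mono) auto
  also have "\<dots> < 1 * r"
    using radius_bound r0 by (intro mult_strict_right_mono) auto
  finally show False using assms by simp
qed

lemma r_ge0: "0 \<le> r"
  using r0 by simp

lemma base: "torus_base r N \<in> torus r N"
  by (rule torus_base_in_torus[OF r_ge0])

lemma torus_nonzero: "z \<in> torus r N \<Longrightarrow> i \<in> {1..N} \<Longrightarrow> z i \<noteq> 0"
  using torus_norm[of z r N i] r0 by auto

lemma continuous_on_coord: "continuous_on (torus r N) (\<lambda>z. z i)"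
  by (rule continuous_on_subset[OF continuous_on_product_coordinates subset_UNIV])

lemma continuous_on_Dfac: "continuous_on (torus r N) (\<lambda>z. Dfac q (z i) (z j))"
  unfolding Dfac_def
  by (intro continuous_on_diff continuous_on_mult continuous_on_const continuous_on_coord)

lemma continuous_on_Sfac:
  assumes "\<alpha> \<in> {1..N}" "\<beta> \<in> {1..N}"
  shows "continuous_on (torus r N) (\<lambda>z. Sfac q z \<beta> \<alpha>)"
  unfolding Sfac_eq using assms
  by (intro continuous_on_divide continuous_on_minus continuous_on_Dfac ballI Dfac_nonzero)
    (auto simp: torus_norm)

lemma continuous_on_coord_power:
  "i \<in> {1..N} \<Longrightarrow> continuous_on (torus r N) (\<lambda>z. z i powi m)"
  by (intro continuous_on_power_int continuous_on_coord) (auto simp: torus_nonzero)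

lemma continuous_on_bethe_term:
  assumes "\<sigma> permutes {1..N}"
  shows "continuous_on (torus r N) (bethe_term N q X \<sigma>)"
proof -
  have "continuous_on (torus r N) (Aperm N q \<sigma>)"
    unfolding Aperm_def[abs_def] case_prod_beta
    by (intro continuous_on_prod continuous_on_Sfac) (auto simp: inversions_def)
  moreover have "continuous_on (torus r N) (\<lambda>z. \<Prod>i=1..N. z (\<sigma> i) powi X i)"
    using permutes_in_image[OF assms] by (intro continuous_on_prod continuous_on_coord_power) simp
  ultimately show ?thesis
    unfolding bethe_term_def[abs_def] by (rule continuous_on_mult)
qed

lemma continuous_on_bethe: "continuous_on (torus r N) (bethe N q X)"
  unfolding bethe_def[abs_def] by (intro continuous_on_sum continuous_on_bethe_term) simp

lemma continuous_on_monom_inv: "continuous_on (torus r N) (monom_inv N Y)"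
  unfolding monom_inv_def[abs_def] by (intro continuous_on_prod continuous_on_coord_power)

lemma continuous_on_epsilon:
  "i \<in> {1..N} \<Longrightarrow> continuous_on (torus r N) (\<lambda>z. epsilon (z i))"
  unfolding epsilon_def
  by (intro continuous_on_diff continuous_on_divide continuous_on_const continuous_on_coord)
    (auto simp: torus_nonzero)

lemma continuous_on_energy: "continuous_on (torus r N) (energy N)"
  unfolding energy_def[abs_def] by (intro continuous_on_sum continuous_on_epsilon)

text \<open>\<open>D(z\<^sub>k, z\<^sub>k\<^sub>+\<^sub>1)\<close> times the Bethe sum is antisymmetric under exchanging \<open>z\<^sub>k\<close> and \<open>z\<^sub>k\<^sub>+\<^sub>1\<close>.\<close>

lemma torus_avg_antisymmetric:
  assumes k: "1 \<le> k" "k < N" and contG: "continuous_on (torus r N) G"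
    and symG: "\<And>z. G (z \<circ> Transposition.transpose k (Suc k)) = G z"
  shows "torus_avg r N (\<lambda>z. Dfac q (z k) (z (Suc k)) * bethe N q X z * G z) (torus_base r N) = 0"
proof -
  let ?s = "Transposition.transpose k (Suc k)"
  let ?T = "{\<sigma>. \<sigma> permutes {1..N} \<and> inv \<sigma> k < inv \<sigma> (Suc k)}"
  \<comment> \<open>This is the half of the Bethe sum with k before k+1. In the other half
    \<open>Dfac\<close> cancels the denominator of \<open>Sfac q z (Suc k) k\<close>, which turns it
    into minus the same expression with the two variables exchanged.\<close>
  define H where "H z = Dfac q (z k) (z (Suc k)) * (\<Sum>\<sigma>\<in>?T. bethe_term N q X \<sigma> z) * G z" for z
  have contH: "continuous_on (torus r N) H"
    unfolding H_def[abs_def]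
    by (intro continuous_on_mult continuous_on_sum continuous_on_Dfac contG continuous_on_bethe_term) simp
  have mem: "z \<circ> ?s \<in> torus r N" if "z \<in> torus r N" for z
    by (rule torus_transpose[OF k that])
  have contHs: "continuous_on (torus r N) (\<lambda>z. H (z \<circ> ?s))"
  proof (rule continuous_on_compose2[OF contH])
    show "continuous_on (torus r N) (\<lambda>z. z \<circ> ?s)"
    proof (rule continuous_on_coordinatewise_then_product)
      show "continuous_on (torus r N) (\<lambda>z. (z \<circ> ?s) i)" for i
        unfolding o_apply by (rule continuous_on_coord)
    qed
    show "(\<lambda>z. z \<circ> ?s) ` torus r N \<subseteq> torus r N"
      by (rule image_subsetI) (rule mem)
  qed
  have "Dfac q (z k) (z (Suc k)) * bethe N q X z * G z = H z - H (z \<circ> ?s)"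
    if z: "z \<in> torus r N" for z
  proof -
    have nz: "Dfac q (z k) (z (Suc k)) \<noteq> 0"
      using k by (intro Dfac_nonzero) (auto simp: torus_norm[OF z])
    have "Dfac q (z k) (z (Suc k)) * bethe N q X z
      = (\<Sum>\<sigma>\<in>?T. Dfac q (z k) (z (Suc k)) * bethe_term N q X \<sigma> z
          - Dfac q (z (Suc k)) (z k) * bethe_term N q X \<sigma> (z \<circ> ?s))"
      unfolding bethe_split[OF k] sum_distrib_left
    proof (rule sum.cong[OF refl])
      fix \<sigma>
      have "Dfac q (z k) (z (Suc k)) * Sfac q z (Suc k) k = - Dfac q (z (Suc k)) (z k)"
        using nz by (simp add: Sfac_eq)
      then show "Dfac q (z k) (z (Suc k)) * (bethe_term N q X \<sigma> z + Sfac q z (Suc k) k * bethe_term N q X \<sigma> (z \<circ> ?s))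
        = Dfac q (z k) (z (Suc k)) * bethe_term N q X \<sigma> z
          - Dfac q (z (Suc k)) (z k) * bethe_term N q X \<sigma> (z \<circ> ?s)"
        by (simp only: distrib_left mult.assoc[symmetric]) simp
    qed
    also have "\<dots> = Dfac q (z k) (z (Suc k)) * (\<Sum>\<sigma>\<in>?T. bethe_term N q X \<sigma> z)
        - Dfac q (z (Suc k)) (z k) * (\<Sum>\<sigma>\<in>?T. bethe_term N q X \<sigma> (z \<circ> ?s))"
      by (simp add: sum_subtractf sum_distrib_left)
    finally show ?thesis
      unfolding H_def symG by (simp only: left_diff_distrib o_apply transpose_apply_first transpose_apply_second)
  qed
  then have "torus_avg r N (\<lambda>z. Dfac q (z k) (z (Suc k)) * bethe N q X z * G z) (torus_base r N)
      = torus_avg r N (\<lambda>z. H z - H (z \<circ> ?s)) (torus_base r N)"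
    by (rule torus_avg_cong[OF _ r_ge0 order.refl base])
  also have "\<dots> = torus_avg r N H (torus_base r N) - torus_avg r N (\<lambda>z. H (z \<circ> ?s)) (torus_base r N)"
    by (rule torus_avg_diff[OF contH contHs r_ge0 order.refl base])
  also have "\<dots> = 0"
    using torus_avg_swap[OF contH r_ge0 k] by (simp only: diff_self)
  finally show ?thesis .
qed

definition amplitude :: "(nat \<Rightarrow> int) \<Rightarrow> nat \<Rightarrow> (nat \<Rightarrow> int) \<Rightarrow> complex" where
  "amplitude X n Y = torus_avg r N (\<lambda>z. bethe N q X z * monom_inv N Y z * energy N z ^ n) (torus_base r N)"

lemma amplitude_diff:
  assumes "k \<in> {1..N}"
  shows "amplitude X n (Y(k := Y k + 1)) - amplitude X n Y
    = torus_avg r N (\<lambda>z. bethe N q X z * monom_inv N Y z * energy N z ^ n * epsilon (z k)) (torus_base r N)"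
proof -
  have "amplitude X n (Y(k := Y k + 1)) - amplitude X n Y
    = torus_avg r N (\<lambda>z. bethe N q X z * monom_inv N (Y(k := Y k + 1)) z * energy N z ^ n
        - bethe N q X z * monom_inv N Y z * energy N z ^ n) (torus_base r N)"
    unfolding amplitude_def
    by (rule torus_avg_diff[OF _ _ r_ge0 order.refl base, symmetric];
      intro continuous_on_mult continuous_on_power continuous_on_bethe continuous_on_monom_inv
        continuous_on_energy)
  also have "\<dots> = torus_avg r N (\<lambda>z. bethe N q X z * monom_inv N Y z * energy N z ^ n * epsilon (z k))
      (torus_base r N)"
  proof (rule torus_avg_cong[OF _ r_ge0 order.refl base])
    fix z assume "z \<in> torus r N"
    then have "monom_inv N (Y(k := Y k + 1)) z = monom_inv N Y z / z k"
      by (intro monom_inv_update torus_nonzero assms)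
    then show "bethe N q X z * monom_inv N (Y(k := Y k + 1)) z * energy N z ^ n
        - bethe N q X z * monom_inv N Y z * energy N z ^ n
      = bethe N q X z * monom_inv N Y z * energy N z ^ n * epsilon (z k)"
      by (simp only: epsilon_def) (simp add: algebra_simps)
  qed
  finally show ?thesis .
qed

lemma amplitude_Suc:
  "amplitude X (Suc n) Y = (\<Sum>k=1..N. amplitude X n (Y(k := Y k + 1)) - amplitude X n Y)"
proof -
  have "amplitude X (Suc n) Y = torus_avg r N (\<lambda>z. \<Sum>k=1..N.
      bethe N q X z * monom_inv N Y z * energy N z ^ n * epsilon (z k)) (torus_base r N)"
    unfolding amplitude_def sum_distrib_left[symmetric] energy_def[symmetric]
    by (simp only: power_Suc2 mult.assoc)
  also have "\<dots> = (\<Sum>k=1..N. torus_avg r N (\<lambda>z.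
      bethe N q X z * monom_inv N Y z * energy N z ^ n * epsilon (z k)) (torus_base r N))"
    by (rule torus_avg_sum[OF _ _ r_ge0 order.refl base])
      (auto intro!: continuous_on_mult continuous_on_power continuous_on_bethe continuous_on_monom_inv
        continuous_on_energy continuous_on_epsilon)
  finally show ?thesis by (simp add: amplitude_diff)
qed

text \<open>The difference of the two sides has the factor epsilon(z_{k+1}) - q epsilon(z_k), which
  is \<open>Dfac\<close> over the product of the two variables. What remains next to the Bethe sum
  is symmetric in them, because equal exponents in \<open>Y\<close> make the monomial symmetric, so
  the average vanishes by antisymmetry.\<close>

lemma amplitude_boundary:
  assumes k: "1 \<le> k" "k < N" and Y: "Y (Suc k) = Y k"
  shows "amplitude X n (Y(Suc k := Y (Suc k) + 1)) - amplitude X n Y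
    = of_real q * (amplitude X n (Y(k := Y k + 1)) - amplitude X n Y)"
proof -
  let ?s = "Transposition.transpose k (Suc k)"
  let ?c = "\<lambda>z. bethe N q X z * monom_inv N Y z * energy N z ^ n"
  let ?G = "\<lambda>z. monom_inv N Y z * energy N z ^ n / (z k * z (Suc k))"
  have s: "?s permutes {1..N}" by (rule permutes_swap_id) (use k in auto)
  have Ys: "Y (?s j) = Y j" for j using Y by (auto simp: Transposition.transpose_def)
  have kN: "k \<in> {1..N}" "Suc k \<in> {1..N}" using k by auto
  have cont: "continuous_on (torus r N) (\<lambda>z. ?c z * epsilon (z j))" if "j \<in> {1..N}" for j
    using that
    by (intro continuous_on_mult continuous_on_power continuous_on_bethe continuous_on_monom_inv
        continuous_on_energy continuous_on_epsilon)
  have "amplitude X n (Y(Suc k := Y (Suc k) + 1)) - amplitude X n Y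
      - of_real q * (amplitude X n (Y(k := Y k + 1)) - amplitude X n Y)
    = torus_avg r N (\<lambda>z. ?c z * epsilon (z (Suc k))) (torus_base r N)
      - torus_avg r N (\<lambda>z. of_real q * (?c z * epsilon (z k))) (torus_base r N)"
    unfolding amplitude_diff[OF kN(1)] amplitude_diff[OF kN(2)] torus_avg_scale ..
  also have "\<dots> = torus_avg r N (\<lambda>z. ?c z * epsilon (z (Suc k)) - of_real q * (?c z * epsilon (z k)))
      (torus_base r N)"
    by (intro torus_avg_diff[OF _ _ r_ge0 order.refl base, symmetric] cont continuous_on_mult_left kN)
  also have "\<dots> = torus_avg r N (\<lambda>z. Dfac q (z k) (z (Suc k)) * bethe N q X z * ?G z) (torus_base r N)"
  proof (rule torus_avg_cong[OF _ r_ge0 order.refl base])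
    fix z assume z: "z \<in> torus r N"
    have nz: "z k \<noteq> 0" "z (Suc k) \<noteq> 0" using torus_nonzero[OF z] kN by auto
    have "epsilon (z (Suc k)) - of_real q * epsilon (z k) = Dfac q (z k) (z (Suc k)) / (z k * z (Suc k))"
      using nz by (simp add: epsilon_def Dfac_def field_simps)
    then have "?c z * (epsilon (z (Suc k)) - of_real q * epsilon (z k))
        = ?c z * (Dfac q (z k) (z (Suc k)) / (z k * z (Suc k)))"
      by (simp only:)
    moreover have "?c z * (epsilon (z (Suc k)) - of_real q * epsilon (z k))
        = ?c z * epsilon (z (Suc k)) - of_real q * (?c z * epsilon (z k))"
      by (simp only: right_diff_distrib mult_ac)
    moreover have "?c z * (Dfac q (z k) (z (Suc k)) / (z k * z (Suc k)))
        = Dfac q (z k) (z (Suc k)) * bethe N q X z * ?G z"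
      by (simp only: divide_inverse mult_ac)
    ultimately show "?c z * epsilon (z (Suc k)) - of_real q * (?c z * epsilon (z k))
        = Dfac q (z k) (z (Suc k)) * bethe N q X z * ?G z"
      by (simp only:)
  qed
  also have "\<dots> = 0"
  proof (rule torus_avg_antisymmetric[OF k])
    show "continuous_on (torus r N) ?G"
      by (intro continuous_on_mult continuous_on_divide continuous_on_power continuous_on_monom_inv
          continuous_on_energy continuous_on_coord)
         (use kN in \<open>auto simp: torus_nonzero\<close>)
    show "?G (z \<circ> ?s) = ?G z" for z
    proof -
      have "monom_inv N Y (z \<circ> ?s) = monom_inv N Y z"
        by (rule permute_monom_inv[OF s]) (rule Ys)
      then show ?thesis
        unfolding permute_energy[OF s] by (simp add: mult.commute)
    qed
  qed
  finally show ?thesis by simp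
qed

lemma amplitude_backward:
  assumes Y: "Y \<in> confs N"
  shows "amplitude X (Suc n) Y = (\<Sum>x\<in>occupied N Y. of_real (qint q (eta N Y x)) *
      (amplitude X n (jump N Y x) - amplitude X n Y))"
proof -
  let ?m = "\<lambda>x. LEAST j. 1 \<le> j \<and> j \<le> N \<and> Y j = x"
  let ?a = "\<lambda>k. amplitude X n (Y(k := Y k + 1)) - amplitude X n Y"
  have "amplitude X (Suc n) Y = (\<Sum>x\<in>occupied N Y. of_real (qint q (eta N Y x)) * ?a (?m x))"
    unfolding amplitude_Suc by (rule sum_blocks[OF Y]) (rule amplitude_boundary)
  also have "\<dots> = (\<Sum>x\<in>occupied N Y. of_real (qint q (eta N Y x)) *
      (amplitude X n (jump N Y x) - amplitude X n Y))"
  proof (rule sum.cong[OF refl])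
    fix x assume x: "x \<in> occupied N Y"
    obtain m where m: "m \<in> {1..N}" "Y m = x" "?m x = m" "{j \<in> {1..N}. Y j = x} = {m..<m + eta N Y x}"
      by (rule confs_fiber[OF Y x])
    have "Y (?m x) = x" unfolding m(3) by (rule m(2))
    then show "of_real (qint q (eta N Y x)) * ?a (?m x)
        = of_real (qint q (eta N Y x)) * (amplitude X n (jump N Y x) - amplitude X n Y)"
      by (simp add: jump_def)
  qed
  finally show ?thesis .
qed

end

section \<open>The initial condition: contour shifts\<close>

lemma torus_avg_const: "torus_avg r n (\<lambda>_. c) z = c"
proof (induction n arbitrary: z)
  case (Suc n)
  then have "torus_avg r n (\<lambda>_. c) = (\<lambda>_. c)" by auto
  then show ?case by (simp add: circle_avg_const)
qed simp

text \<open>The set \<open>I\<close> and the exponents \<open>e\<close> are arbitrary, so that the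
  induction that integrates out the largest index can discard pairs without constructing a
  permutation of fewer letters.\<close>

definition pair_term ::
  "nat \<Rightarrow> real \<Rightarrow> (nat \<times> nat) set \<Rightarrow> (nat \<Rightarrow> int) \<Rightarrow> (nat \<Rightarrow> complex) \<Rightarrow> complex" where
  "pair_term N q I e z = (\<Prod>(\<alpha>, \<beta>)\<in>I. Sfac q z \<beta> \<alpha>) * (\<Prod>j=1..N. z j powi e j)"

context qtazrp
begin

lemma continuous_on_pair_term:
  assumes "I \<subseteq> {1..N} \<times> {1..N}"
  shows "continuous_on (torus r N) (pair_term N q I e)"
  unfolding pair_term_def[abs_def] case_prod_beta using assms
  by (intro continuous_on_mult continuous_on_prod continuous_on_Sfac continuous_on_coord_power) auto

text \<open>As \<open>k\<close> is never a first index, its variable enters denominators only as the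
  second argument of \<open>Dfac\<close>, where the whole closed disc is allowed. With a nonnegative
  exponent the integrand is holomorphic there and the mean value property applies.\<close>

lemma circle_avg_inside:
  assumes I: "I \<subseteq> {1..N} \<times> {1..N}" and k: "k \<in> {1..N}" and z: "z \<in> torus r N"
    and nk: "\<And>\<alpha> \<beta>. (\<alpha>, \<beta>) \<in> I \<Longrightarrow> \<alpha> \<noteq> k" and e: "0 \<le> e k"
  shows "circle_avg r k (pair_term N q I e) z = pair_term N q I e (z(k := 0))"
proof -
  have hol: "(\<lambda>w. pair_term N q I e (z(k := w))) holomorphic_on cball 0 r"
  proof -
    have "(\<lambda>w. Sfac q (z(k := w)) \<beta> \<alpha>) holomorphic_on cball 0 r" if p: "(\<alpha>, \<beta>) \<in> I" for \<alpha> \<beta>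
    proof -
      have \<alpha>: "\<alpha> \<noteq> k" and z\<alpha>: "norm (z \<alpha>) = r"
        using nk[OF p] p I torus_norm[OF z] by auto
      have "Dfac q (z \<alpha>) ((z(k := w)) \<beta>) \<noteq> 0" if "w \<in> cball 0 r" for w
        using that p I torus_norm[OF z] by (intro Dfac_nonzero z\<alpha>) auto
      moreover have "(\<lambda>w. (z(k := w)) \<beta>) holomorphic_on cball 0 r"
        by (cases "\<beta> = k") (auto intro: holomorphic_intros)
      ultimately have "(\<lambda>w. - Dfac q ((z(k := w)) \<beta>) (z \<alpha>) / Dfac q (z \<alpha>) ((z(k := w)) \<beta>)) holomorphic_on cball 0 r"
        unfolding Dfac_def by (intro holomorphic_intros) auto
      then show ?thesis
        using \<alpha> by (simp add: Sfac_eq)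
    qed
    moreover have "(\<lambda>w. (z(k := w)) j powi e j) holomorphic_on cball 0 r" for j
      using e by (cases "j = k") (auto simp: power_int_def intro!: holomorphic_intros)
    ultimately show ?thesis
      unfolding pair_term_def case_prod_beta
      by (intro holomorphic_on_mult holomorphic_on_prod) auto
  qed
  show ?thesis
  proof (rule circle_avg_mean_value[OF _ _ r0])
    show "continuous_on (cball 0 r) (\<lambda>w. pair_term N q I e (z(k := w)))"
      by (rule holomorphic_on_imp_continuous_on[OF hol])
    show "(\<lambda>w. pair_term N q I e (z(k := w))) holomorphic_on ball 0 r"
      by (rule holomorphic_on_subset[OF hol]) auto
  qed
qed

lemma torus_avg_inside_vanishes:
  assumes I: "I \<subseteq> {1..N} \<times> {1..N}" and k: "k \<in> {1..N}"
    and nk: "\<And>\<alpha> \<beta>. (\<alpha>, \<beta>) \<in> I \<Longrightarrow> \<alpha> \<noteq> k" and e: "0 < e k"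
  shows "torus_avg r N (pair_term N q I e) (torus_base r N) = 0"
proof (rule torus_avg_eq_0I[OF continuous_on_pair_term[OF I] r_ge0 k base])
  fix z assume z: "z \<in> torus r N"
  have "circle_avg r k (pair_term N q I e) z = pair_term N q I e (z(k := 0))"
    by (rule circle_avg_inside[OF I k z nk]) (use e in simp_all)
  also have "\<dots> = 0"
    unfolding pair_term_def using k e by (auto intro!: bexI[of _ k])
  finally show "circle_avg r k (pair_term N q I e) z = 0" .
qed

text \<open>The expression is w times \<open>Dfac q (r^2 / w) v\<close>, which stays meaningful at w
  = 0. Its first term dominates by the same radius estimate as in
  \<open>Dfac_nonzero\<close>.\<close>

lemma reflected_denominator_nonzero:
  assumes "norm v = r" "norm w \<le> r"
  shows "of_real (r\<^sup>2) * (1 - (1 - of_real q) * v) - of_real q * w * v \<noteq> (0::complex)"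
proof
  assume "of_real (r\<^sup>2) * (1 - (1 - of_real q) * v) - of_real q * w * v = (0::complex)"
  then have "of_real (r\<^sup>2) = of_real (r\<^sup>2) * (of_real (1 - q) * v) + of_real q * w * v"
    by (simp add: algebra_simps)
  then have "norm (of_real (r\<^sup>2) :: complex)
      \<le> norm (of_real (r\<^sup>2) * (of_real (1 - q) * v)) + norm (of_real q * w * v)"
    by (metis norm_triangle_ineq)
  then have "r\<^sup>2 \<le> r\<^sup>2 * (\<bar>1 - q\<bar> * r) + \<bar>q\<bar> * norm w * r"
    by (simp add: norm_mult assms del: of_real_diff of_real_power)
  also have "\<dots> \<le> r\<^sup>2 * (\<bar>1 - q\<bar> * r) + \<bar>q\<bar> * r * r"
    using assms r0 by (intro add_left_mono mult_right_mono mult_left_mono) auto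
  also have "\<dots> = r\<^sup>2 * (\<bar>q\<bar> + \<bar>1 - q\<bar> * r)"
    by (simp add: power2_eq_square algebra_simps)
  also have "\<dots> < r\<^sup>2 * 1"
    using r0 radius_bound by (intro mult_strict_left_mono) auto
  finally show False by simp
qed

text \<open>As \<open>k\<close> is never a second index, its variable can be sent to infinity: the
  scattering factors stay finite there and the negative power tends to 0.\<close>

lemma torus_avg_outside_vanishes:
  assumes I: "I \<subseteq> {1..N} \<times> {1..N}" and k: "k \<in> {1..N}"
    and nk: "\<And>\<alpha> \<beta>. (\<alpha>, \<beta>) \<in> I \<Longrightarrow> \<beta> \<noteq> k" and e: "e k < 0"
  shows "torus_avg r N (pair_term N q I e) (torus_base r N) = 0"
proof (rule torus_avg_eq_0I[OF continuous_on_pair_term[OF I] r_ge0 k base])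
  fix z assume z: "z \<in> torus r N"
  let ?R = "of_real (r\<^sup>2) :: complex"
  \<comment> \<open>The scattering factor at r^2 / w, with numerator and denominator multiplied by w
    to remove the singularity at w = 0.\<close>
  define S where "S \<alpha> \<beta> w = (if \<alpha> = k
    then - (w * z \<beta> - ?R * (of_real q + (1 - of_real q) * z \<beta>))
      / (?R * (1 - (1 - of_real q) * z \<beta>) - of_real q * w * z \<beta>)
    else Sfac q z \<beta> \<alpha>)" for \<alpha> \<beta> w
  define g where "g w = (\<Prod>(\<alpha>, \<beta>)\<in>I. S \<alpha> \<beta> w) *
    ((w / ?R) ^ nat (- e k) * (\<Prod>j\<in>{1..N} - {k}. z j powi e j))" for w
  have hol: "g holomorphic_on cball 0 r"
  proof -
    have "S \<alpha> \<beta> holomorphic_on cball 0 r" if p: "(\<alpha>, \<beta>) \<in> I" for \<alpha> \<beta>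
    proof (cases "\<alpha> = k")
      case True
      have "norm (z \<beta>) = r" using p I torus_norm[OF z] by auto
      then show ?thesis
        unfolding S_def[abs_def] using True reflected_denominator_nonzero
        by (auto intro!: holomorphic_intros)
    qed (simp add: S_def[abs_def])
    then show ?thesis
      unfolding g_def[abs_def] case_prod_beta using r0
      by (intro holomorphic_on_mult holomorphic_on_prod holomorphic_intros) auto
  qed
  have "circle_avg r k (pair_term N q I e) z = g 0"
  proof (rule circle_avg_mean_value_outside[OF _ _ r0])
    show "continuous_on (cball 0 r) g"
      by (rule holomorphic_on_imp_continuous_on[OF hol])
    show "g holomorphic_on ball 0 r"
      by (rule holomorphic_on_subset[OF hol]) auto
    fix w :: complex assume w: "norm w = r"
    then have w0: "w \<noteq> 0" using r0 by auto
    let ?z = "z(k := ?R / w)"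
    have "Sfac q ?z \<beta> \<alpha> = S \<alpha> \<beta> w" if p: "(\<alpha>, \<beta>) \<in> I" for \<alpha> \<beta>
    proof (cases "\<alpha> = k")
      case True
      have "\<beta> \<noteq> k" using nk[OF p] .
      have num: "z \<beta> - of_real q * (?R / w) - (1 - of_real q) * (?R / w) * z \<beta>
          = (w * z \<beta> - ?R * (of_real q + (1 - of_real q) * z \<beta>)) / w"
        using w0 by (simp add: field_simps)
      have den: "?R / w - of_real q * z \<beta> - (1 - of_real q) * (?R / w) * z \<beta>
          = (?R * (1 - (1 - of_real q) * z \<beta>) - of_real q * w * z \<beta>) / w"
        using w0 by (simp add: field_simps)
      have "Sfac q ?z \<beta> \<alpha> = - (z \<beta> - of_real q * (?R / w) - (1 - of_real q) * (?R / w) * z \<beta>)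
          / (?R / w - of_real q * z \<beta> - (1 - of_real q) * (?R / w) * z \<beta>)"
        using True \<open>\<beta> \<noteq> k\<close> by (simp add: Sfac_def)
      also have "\<dots> = S \<alpha> \<beta> w"
        unfolding num den S_def using True w0 by (simp add: divide_divide_eq_right)
      finally show ?thesis .
    next
      case False
      then show ?thesis using nk[OF p] by (simp add: S_def Sfac_def)
    qed
    then have "(\<Prod>(\<alpha>, \<beta>)\<in>I. Sfac q ?z \<beta> \<alpha>) = (\<Prod>(\<alpha>, \<beta>)\<in>I. S \<alpha> \<beta> w)"
      by (intro prod.cong) auto
    moreover have "(\<Prod>j=1..N. ?z j powi e j) = (?R / w) powi e k * (\<Prod>j\<in>{1..N} - {k}. z j powi e j)"
      using k by (subst prod.remove[of _ k]) (auto intro!: prod.cong)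
    moreover have "(?R / w) powi e k = (w / ?R) ^ nat (- e k)"
      using e by (simp add: power_int_def)
    ultimately show "pair_term N q I e ?z = g w"
      unfolding pair_term_def g_def by simp
  qed
  also have "g 0 = 0"
    using e by (simp add: g_def)
  finally show "circle_avg r k (pair_term N q I e) z = 0" .
qed

text \<open>The largest index occurs only as \<beta>, so its average is the value at
  \<open>z \<beta> = 0\<close>, where every \<open>Sfac q z \<beta> \<alpha>\<close> equals q. Each
  pair ending in that index thus contributes one factor q, and the induction goes on with the
  remaining pairs.\<close>

lemma torus_avg_Sfac_prod:
  assumes "\<And>\<alpha> \<beta>. (\<alpha>, \<beta>) \<in> I \<Longrightarrow> 1 \<le> \<alpha> \<and> \<alpha> < \<beta> \<and> \<beta> \<le> n" "n \<le> N"
  shows "torus_avg r N (pair_term N q I (\<lambda>_. 0)) (torus_base r N) = of_real q ^ card I"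
  using assms
proof (induction n arbitrary: I)
  case 0
  then have "I = {}" by force
  then show ?case by (simp add: pair_term_def torus_avg_const)
next
  case (Suc n)
  let ?k = "Suc n"
  define I1 I2 where "I1 = {p \<in> I. snd p \<noteq> ?k}" and "I2 = {p \<in> I. snd p = ?k}"
  have I: "I \<subseteq> {1..N} \<times> {1..N}" using Suc.prems by force
  then have fin: "finite I" by (rule finite_subset) simp
  have split: "I = I1 \<union> I2" "I1 \<inter> I2 = {}" "finite I1" "finite I2"
    using fin by (auto simp: I1_def I2_def)
  have kN: "?k \<in> {1..N}" using Suc.prems by auto
  have "circle_avg r ?k (pair_term N q I (\<lambda>_. 0)) z = of_real q ^ card I2 * pair_term N q I1 (\<lambda>_. 0) z"
    if z: "z \<in> torus r N" for z
  proof -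
    have "circle_avg r ?k (pair_term N q I (\<lambda>_. 0)) z = pair_term N q I (\<lambda>_. 0) (z(?k := 0))"
      by (rule circle_avg_inside[OF I kN z]) (use Suc.prems in force, simp)
    also have "\<dots> = (\<Prod>(\<alpha>, \<beta>)\<in>I1. Sfac q (z(?k := 0)) \<beta> \<alpha>) * (\<Prod>(\<alpha>, \<beta>)\<in>I2. Sfac q (z(?k := 0)) \<beta> \<alpha>)"
      unfolding pair_term_def split(1) using prod.union_disjoint[OF split(3,4,2)] by simp
    also have "(\<Prod>(\<alpha>, \<beta>)\<in>I1. Sfac q (z(?k := 0)) \<beta> \<alpha>) = pair_term N q I1 (\<lambda>_. 0) z"
    proof -
      have "\<alpha> \<noteq> ?k" "\<beta> \<noteq> ?k" if "(\<alpha>, \<beta>) \<in> I1" for \<alpha> \<beta>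
        using that Suc.prems(1)[of \<alpha> \<beta>] by (auto simp: I1_def)
      then show ?thesis
        unfolding pair_term_def by (simp, intro prod.cong) (auto simp: Sfac_def)
    qed
    also have "(\<Prod>(\<alpha>, \<beta>)\<in>I2. Sfac q (z(?k := 0)) \<beta> \<alpha>) = (\<Prod>p\<in>I2. of_real q)"
    proof (rule prod.cong[OF refl])
      fix p assume "p \<in> I2"
      then obtain \<alpha> where p: "p = (\<alpha>, ?k)" "(\<alpha>, ?k) \<in> I" by (cases p) (auto simp: I2_def)
      then have "\<alpha> \<noteq> ?k" "\<alpha> \<in> {1..N}" using Suc.prems(1)[OF p(2)] Suc.prems(2) by auto
      moreover have "z \<alpha> \<noteq> 0" using torus_nonzero[OF z] calculation by blast
      ultimately show "(case p of (\<alpha>, \<beta>) \<Rightarrow> Sfac q (z(?k := 0)) \<beta> \<alpha>) = of_real q"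
        unfolding p(1) by (simp add: Sfac_def)
    qed
    finally show ?thesis by simp
  qed
  then have "torus_avg r N (circle_avg r ?k (pair_term N q I (\<lambda>_. 0))) (torus_base r N)
      = torus_avg r N (\<lambda>z. of_real q ^ card I2 * pair_term N q I1 (\<lambda>_. 0) z) (torus_base r N)"
    by (rule torus_avg_cong[OF _ r_ge0 order.refl base])
  also have "\<dots> = of_real q ^ card I2 * of_real q ^ card I1"
  proof -
    have "torus_avg r N (pair_term N q I1 (\<lambda>_. 0)) (torus_base r N) = of_real q ^ card I1"
      by (rule Suc.IH) (use Suc.prems in \<open>force simp: I1_def\<close>)+
    then show ?thesis unfolding torus_avg_scale by simp
  qed
  also have "\<dots> = of_real q ^ card I"
    using card_Un_disjoint[OF split(3,4,2)] split(1) by (simp add: power_add mult.commute)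
  finally show ?case
    using circle_avg_torus_avg[OF continuous_on_pair_term[OF I] r_ge0 kN base] by simp
qed

end

section \<open>The initial condition: combinatorics of inversions\<close>

text \<open>Pigeonhole: otherwise \<tau> would map {k+1..N} onto itself, leaving no room there for
  the value at \<open>i\<close>.\<close>

lemma exists_crossing_down:
  fixes \<tau> :: "nat \<Rightarrow> nat"
  assumes \<tau>: "\<tau> permutes {1..N}" and i: "1 \<le> i" "i \<le> k" "k < \<tau> i" "k \<le> N"
  shows "\<exists>j. k < j \<and> j \<le> N \<and> \<tau> j \<le> k"
proof (rule ccontr)
  assume "\<not> ?thesis"
  then have "\<tau> j \<in> {Suc k..N}" if "j \<in> {Suc k..N}" for j
    using that permutes_in_image[OF \<tau>, of j] by force
  then have "\<tau> ` {Suc k..N} = {Suc k..N}"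
    by (intro card_subset_eq) (auto simp: card_image inj_on_subset[OF permutes_inj[OF \<tau>]])
  moreover have "\<tau> i \<in> {Suc k..N}"
    using i permutes_in_image[OF \<tau>, of i] by auto
  ultimately have "\<tau> i \<in> \<tau> ` {Suc k..N}" by simp
  then show False
    using i by (simp add: inj_image_mem_iff[OF permutes_inj[OF \<tau>]])
qed

text \<open>\<open>\<tau>\<close> either preserves the prefix \<open>{1..k}\<close> or has a left-to-right maximum \<open>i \<le> k\<close> with
  \<open>\<tau> i > k\<close> and a right-to-left minimum \<open>j > k\<close> with \<open>\<tau> j \<le> k\<close>; in the second case
  \<open>y\<^sub>k \<le> y\<^sub>i \<le> x\<^bsub>\<tau> i\<^esub> \<le> x\<^sub>k\<^sub>+\<^sub>1 \<le> x\<^sub>k \<le> x\<^bsub>\<tau> j\<^esub> \<le> y\<^sub>j \<le> y\<^sub>k\<^sub>+\<^sub>1 \<le> y\<^sub>k\<close>.\<close>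

lemma prefix_dichotomy:
  fixes X Y :: "nat \<Rightarrow> int"
  assumes \<tau>: "\<tau> permutes {1..N}"
    and X: "\<And>i j. 1 \<le> i \<Longrightarrow> i \<le> j \<Longrightarrow> j \<le> N \<Longrightarrow> X j \<le> X i"
    and Y: "\<And>i j. 1 \<le> i \<Longrightarrow> i \<le> j \<Longrightarrow> j \<le> N \<Longrightarrow> Y j \<le> Y i"
    and RL: "\<And>k. k \<in> {1..N} \<Longrightarrow> (\<And>j. k < j \<Longrightarrow> j \<le> N \<Longrightarrow> \<tau> k < \<tau> j) \<Longrightarrow> X (\<tau> k) \<le> Y k"
    and LR: "\<And>k. k \<in> {1..N} \<Longrightarrow> (\<And>j. 1 \<le> j \<Longrightarrow> j < k \<Longrightarrow> \<tau> j < \<tau> k) \<Longrightarrow> Y k \<le> X (\<tau> k)"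
    and k: "k \<le> N"
  shows "\<tau> ` {1..k} = {1..k} \<or>
    (1 \<le> k \<and> k < N \<and> X (Suc k) = X k \<and> Y (Suc k) = X k \<and> Y k = X k)"
proof (cases "\<tau> ` {1..k} \<subseteq> {1..k}")
  case True
  then show ?thesis
    by (intro disjI1 card_subset_eq) (auto simp: card_image inj_on_subset[OF permutes_inj[OF \<tau>]])
next
  case False
  have inj: "\<tau> i = \<tau> j \<longleftrightarrow> i = j" for i j
    by (rule inj_eq[OF permutes_inj[OF \<tau>]])
  have im: "\<tau> i \<in> {1..N} \<longleftrightarrow> i \<in> {1..N}" for i
    by (rule permutes_in_image[OF \<tau>])
  from False obtain i0 where i0: "i0 \<in> {1..k}" "\<tau> i0 \<notin> {1..k}" by blast
  have i0': "\<tau> i0 \<in> {1..N}" using im[of i0] i0 k by auto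
  then have kN: "1 \<le> k" "k < N" using i0 by auto
  \<comment> \<open>An index at which \<tau> is largest on {1..k} beats all earlier values, hence is
    a left-to-right maximum; its value exceeds k because that of \<open>i0\<close> does.\<close>
  have "\<exists>i\<in>{1..k}. \<forall>j\<in>{1..k}. \<tau> j \<le> \<tau> i"
  proof -
    have "Max (\<tau> ` {1..k}) \<in> \<tau> ` {1..k}" using i0 by (intro Max_in) auto
    then obtain i where "i \<in> {1..k}" and M: "Max (\<tau> ` {1..k}) = \<tau> i" by blast
    then show ?thesis by (intro bexI[of _ i] ballI) (simp_all add: M[symmetric])
  qed
  then obtain i where i: "i \<in> {1..k}" "\<And>j. j \<in> {1..k} \<Longrightarrow> \<tau> j \<le> \<tau> i" by blast
  have ti: "k < \<tau> i" using i(2)[OF i0(1)] i0 i0' by auto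
  have iN: "i \<in> {1..N}" using i k by auto
  have "Y i \<le> X (\<tau> i)"
  proof (rule LR[OF iN])
    fix j assume "1 \<le> j" "j < i"
    then show "\<tau> j < \<tau> i" using i(2)[of j] i(1) inj[of i j] by force
  qed
  then have 1: "Y k \<le> X (Suc k)"
    using Y[of i k] X[of "Suc k" "\<tau> i"] i(1) ti im[of i] iN k by force
  obtain j0 where j0: "k < j0" "j0 \<le> N" "\<tau> j0 \<le> k"
    using exists_crossing_down[OF \<tau>, of i k] i(1) ti k by auto
  have "\<exists>j\<in>{Suc k..N}. \<forall>i\<in>{Suc k..N}. \<tau> j \<le> \<tau> i"
  proof -
    have "Min (\<tau> ` {Suc k..N}) \<in> \<tau> ` {Suc k..N}" using j0 by (intro Min_in) auto
    then obtain j where "j \<in> {Suc k..N}" and M: "Min (\<tau> ` {Suc k..N}) = \<tau> j" by blast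
    then show ?thesis by (intro bexI[of _ j] ballI) (simp_all add: M[symmetric])
  qed
  then obtain j where j: "j \<in> {Suc k..N}" "\<And>i. i \<in> {Suc k..N} \<Longrightarrow> \<tau> j \<le> \<tau> i" by blast
  have tj: "\<tau> j \<le> k" using j(2)[of j0] j0 by auto
  have jN: "j \<in> {1..N}" using j by auto
  have "X (\<tau> j) \<le> Y j"
  proof (rule RL[OF jN])
    fix i assume "j < i" "i \<le> N"
    then show "\<tau> j < \<tau> i" using j(2)[of i] j(1) inj[of i j] by force
  qed
  then have 2: "X k \<le> Y (Suc k)"
    using X[of "\<tau> j" k] Y[of "Suc k" j] j(1) tj im[of j] jN k by force
  show ?thesis
    using 1 2 X[of k "Suc k"] Y[of k "Suc k"] kN by auto
qed

text \<open>If \<tau> preserves both {1..j} and {1..j-1}, it fixes j, which is then an extremum of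
  both kinds, so \<open>RL\<close> and \<open>LR\<close> give two opposite inequalities. If one of
  these prefixes is not preserved, the dichotomy gives the equality at once.\<close>

lemma permutation_rigidity:
  fixes X Y :: "nat \<Rightarrow> int"
  assumes \<tau>: "\<tau> permutes {1..N}"
    and X: "\<And>i j. 1 \<le> i \<Longrightarrow> i \<le> j \<Longrightarrow> j \<le> N \<Longrightarrow> X j \<le> X i"
    and Y: "\<And>i j. 1 \<le> i \<Longrightarrow> i \<le> j \<Longrightarrow> j \<le> N \<Longrightarrow> Y j \<le> Y i"
    and RL: "\<And>k. k \<in> {1..N} \<Longrightarrow> (\<And>j. k < j \<Longrightarrow> j \<le> N \<Longrightarrow> \<tau> k < \<tau> j) \<Longrightarrow> X (\<tau> k) \<le> Y k"
    and LR: "\<And>k. k \<in> {1..N} \<Longrightarrow> (\<And>j. 1 \<le> j \<Longrightarrow> j < k \<Longrightarrow> \<tau> j < \<tau> k) \<Longrightarrow> Y k \<le> X (\<tau> k)"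
    and j: "j \<in> {1..N}"
  shows "X j = Y j" "X (\<tau> j) = X j"
proof -
  have dich: "\<tau> ` {1..k} = {1..k} \<or>
    (1 \<le> k \<and> k < N \<and> X (Suc k) = X k \<and> Y (Suc k) = X k \<and> Y k = X k)" if "k \<le> N" for k
    by (rule prefix_dichotomy[where X=X and Y=Y and \<tau>=\<tau> and N=N, OF \<tau> X Y RL LR that])
  have inj: "\<tau> i = \<tau> j \<longleftrightarrow> i = j" for i j
    by (rule inj_eq[OF permutes_inj[OF \<tau>]])
  have im: "\<tau> i \<in> {1..N} \<longleftrightarrow> i \<in> {1..N}" for i
    by (rule permutes_in_image[OF \<tau>])
  have pres: "\<tau> i \<in> {1..k} \<longleftrightarrow> i \<in> {1..k}" if "\<tau> ` {1..k} = {1..k}" for i k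
    using inj_image_mem_iff[OF permutes_inj[OF \<tau>], of i "{1..k}"] that by simp
  show "X j = Y j"
  proof (cases "\<tau> ` {1..j} = {1..j} \<and> \<tau> ` {1..j - 1} = {1..j - 1}")
    case True
    then have p: "\<tau> i \<in> {1..j} \<longleftrightarrow> i \<in> {1..j}" "\<tau> i \<in> {1..j - 1} \<longleftrightarrow> i \<in> {1..j - 1}" for i
      using pres by blast+
    have tj: "\<tau> j = j" using p[of j] j by auto
    have "X (\<tau> j) \<le> Y j"
    proof (rule RL[OF j])
      fix i assume "j < i" "i \<le> N"
      then show "\<tau> j < \<tau> i" using p(1)[of i] im[of i] tj by auto
    qed
    moreover have "Y j \<le> X (\<tau> j)"
    proof (rule LR[OF j])
      fix i assume "1 \<le> i" "i < j"
      then show "\<tau> i < \<tau> j" using p(2)[of i] tj by auto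
    qed
    ultimately show ?thesis by (simp add: tj)
  next
    case False
    then consider "\<tau> ` {1..j} \<noteq> {1..j}" | "\<tau> ` {1..j - 1} \<noteq> {1..j - 1}" by blast
    then show ?thesis
    proof cases
      case 1
      then show ?thesis using dich[of j] j by auto
    next
      case 2
      moreover have "Suc (j - 1) = j" using j by auto
      ultimately show ?thesis using dich[of "j - 1"] j by auto
    qed
  qed
  \<comment> \<open>A prefix that ends between j and \<open>\<tau> j\<close> contains exactly one of
    them and cannot be preserved, so the dichotomy makes \<open>X\<close> constant from one to the
    other.\<close>
  have chain: "X b = X a" if "a \<le> b" "b \<le> N" "\<And>k. a \<le> k \<Longrightarrow> k < b \<Longrightarrow> \<tau> ` {1..k} \<noteq> {1..k}" for a b
    using that
  proof (induction b rule: dec_induct)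
    case (step b)
    then have "X (Suc b) = X b" using dich[of b] by auto
    then show ?case using step by simp
  qed simp
  show "X (\<tau> j) = X j"
  proof (cases "j \<le> \<tau> j")
    case True
    show ?thesis
    proof (rule chain[OF True])
      show "\<tau> j \<le> N" using im[of j] j by simp
      show "\<tau> ` {1..k} \<noteq> {1..k}" if "j \<le> k" "k < \<tau> j" for k
        using pres[of k j] that j by auto
    qed
  next
    case False
    have "X j = X (\<tau> j)"
    proof (rule chain)
      show "\<tau> j \<le> j" "j \<le> N" using False j by auto
      show "\<tau> ` {1..k} \<noteq> {1..k}" if "\<tau> j \<le> k" "k < j" for k
        using pres[of k j] that j im[of j] by auto
    qed
    then show ?thesis by simp
  qed
qed

section \<open>Inversion generating function of a Young subgroup\<close>

definition ninv :: "nat \<Rightarrow> (nat \<Rightarrow> nat) \<Rightarrow> (nat \<times> nat) set" where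
  "ninv n \<tau> = {(\<alpha>, \<beta>). 1 \<le> \<alpha> \<and> \<alpha> < \<beta> \<and> \<beta> \<le> n \<and> \<tau> \<beta> < \<tau> \<alpha>}"

lemma inversions_eq_ninv: "inversions N \<sigma> = ninv N (inv \<sigma>)"
  by (auto simp: inversions_def ninv_def)

lemma finite_ninv: "finite (ninv n \<tau>)"
  by (rule finite_subset[of _ "{1..n} \<times> {1..n}"]) (auto simp: ninv_def)

text \<open>\<open>insert_last n b\<close> is the cycle that puts \<open>b\<close> at the end of the word \<open>1 \<dots> n+1\<close> and keeps the
  order of the other letters; \<open>extract_last n b\<close> is its inverse.\<close>

definition insert_last :: "nat \<Rightarrow> nat \<Rightarrow> nat \<Rightarrow> nat" where
  "insert_last n b j = (if j = Suc n then b else if b \<le> j \<and> j \<le> n then Suc j else j)"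

definition extract_last :: "nat \<Rightarrow> nat \<Rightarrow> nat \<Rightarrow> nat" where
  "extract_last n b j = (if j = b then Suc n else if b < j \<and> j \<le> Suc n then j - 1 else j)"

lemma insert_extract_last:
  assumes "b \<in> {1..Suc n}"
  shows "insert_last n b (extract_last n b j) = j" "extract_last n b (insert_last n b j) = j"
  using assms by (auto simp: insert_last_def extract_last_def)

lemma insert_last_permutes:
  assumes "b \<in> {1..Suc n}"
  shows "insert_last n b permutes {1..Suc n}"
  by (rule bij_imp_permutes, rule bij_betw_byWitness[where f' = "extract_last n b"])
     (use assms insert_extract_last[OF assms] in \<open>auto simp: insert_last_def extract_last_def\<close>)

lemma extract_last_permutes:
  assumes "b \<in> {1..Suc n}"
  shows "extract_last n b permutes {1..Suc n}"
  by (rule bij_imp_permutes, rule bij_betw_byWitness[where f' = "insert_last n b"])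
     (use assms insert_extract_last[OF assms] in \<open>auto simp: insert_last_def extract_last_def\<close>)

text \<open>Relabelling keeps the relative order of the first n letters and hence their inversions.
  The appended letter b is inverted with exactly the letters above it, of which there are n + 1 -
  b.\<close>

lemma card_ninv_insert_last:
  assumes b: "b \<in> {1..Suc n}" and \<tau>: "\<tau> permutes {1..n}"
  shows "card (ninv (Suc n) (insert_last n b \<circ> \<tau>)) = card (ninv n \<tau>) + (Suc n - b)"
proof -
  let ?c = "insert_last n b"
  have im: "\<tau> i \<in> {1..n} \<longleftrightarrow> i \<in> {1..n}" for i
    by (rule permutes_in_image[OF \<tau>])
  have last: "\<tau> (Suc n) = Suc n" by (rule permutes_not_in[OF \<tau>]) simp
  have mono: "?c i < ?c j \<longleftrightarrow> i < j" if "i \<in> {1..n}" "j \<in> {1..n}" for i j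
    using that by (auto simp: insert_last_def)
  define A where "A = {i. i \<in> {1..n} \<and> b \<le> \<tau> i}"
  have A: "i \<in> A \<longleftrightarrow> i \<in> {1..n} \<and> b \<le> \<tau> i" for i by (simp only: A_def mem_Collect_eq)
  have finA: "finite A" by (rule finite_subset[of _ "{1..n}"]) (use A in blast, simp)
  have gt: "b < ?c (\<tau> i) \<longleftrightarrow> b \<le> \<tau> i" if "i \<in> {1..n}" for i
    using that im[of i] by (auto simp: insert_last_def)
  have eq: "ninv (Suc n) (?c \<circ> \<tau>) = ninv n \<tau> \<union> (\<lambda>i. (i, Suc n)) ` A"
  proof (intro set_eqI iffI)
    fix p assume "p \<in> ninv (Suc n) (?c \<circ> \<tau>)"
    then obtain i j where p: "p = (i, j)" "1 \<le> i" "i < j" "j \<le> Suc n" "?c (\<tau> j) < ?c (\<tau> i)"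
      by (auto simp: ninv_def)
    show "p \<in> ninv n \<tau> \<union> (\<lambda>i. (i, Suc n)) ` A"
    proof (cases "j = Suc n")
      case True
      then have "b < ?c (\<tau> i)" using p last by (simp add: insert_last_def)
      then have "i \<in> A" using gt[of i] p True by (simp add: A)
      then show ?thesis using p True by blast
    next
      case False
      then have "\<tau> j < \<tau> i" using p mono[of "\<tau> j" "\<tau> i"] im[of i] im[of j] by auto
      then show ?thesis using p False by (auto simp: ninv_def)
    qed
  next
    fix p assume "p \<in> ninv n \<tau> \<union> (\<lambda>i. (i, Suc n)) ` A"
    then show "p \<in> ninv (Suc n) (?c \<circ> \<tau>)"
    proof
      assume "p \<in> ninv n \<tau>"
      then obtain i j where p: "p = (i, j)" "1 \<le> i" "i < j" "j \<le> n" "\<tau> j < \<tau> i"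
        by (auto simp: ninv_def)
      then have "?c (\<tau> j) < ?c (\<tau> i)" using mono[of "\<tau> j" "\<tau> i"] im[of i] im[of j] by auto
      then show ?thesis using p by (auto simp: ninv_def)
    next
      assume "p \<in> (\<lambda>i. (i, Suc n)) ` A"
      then obtain i where p: "p = (i, Suc n)" "i \<in> {1..n}" "b \<le> \<tau> i" by (auto simp: A)
      then have "b < ?c (\<tau> i)" using gt[of i] by blast
      then show ?thesis using p last by (auto simp: ninv_def insert_last_def)
    qed
  qed
  have "\<tau> ` A = {b..n}"
  proof
    show "\<tau> ` A \<subseteq> {b..n}"
    proof
      fix j assume "j \<in> \<tau> ` A"
      then obtain i where "i \<in> {1..n}" "b \<le> \<tau> i" "j = \<tau> i" by (auto simp: A)
      then show "j \<in> {b..n}" using im[of i] by simp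
    qed
    show "{b..n} \<subseteq> \<tau> ` A"
    proof
      fix j assume j: "j \<in> {b..n}"
      then have "j \<in> {1..n}" using b by simp
      then have "j \<in> \<tau> ` {1..n}" by (simp only: permutes_image[OF \<tau>])
      then obtain i where "i \<in> {1..n}" "j = \<tau> i" by blast
      then show "j \<in> \<tau> ` A" using j by (intro image_eqI[of _ _ i]) (simp_all add: A)
    qed
  qed
  then have "card A = card {b..n}"
    using card_image[OF inj_on_subset[OF permutes_inj[OF \<tau>] subset_UNIV], of A] by (simp only:)
  moreover have "card ((\<lambda>i. (i, Suc n)) ` A) = card A"
    by (rule card_image) (auto simp: inj_on_def)
  moreover have "card (ninv n \<tau> \<union> (\<lambda>i. (i, Suc n)) ` A)
      = card (ninv n \<tau>) + card ((\<lambda>i. (i, Suc n)) ` A)"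
    by (rule card_Un_disjoint[OF finite_ninv finite_imageI[OF finA]]) (auto simp: ninv_def)
  ultimately show ?thesis unfolding eq by simp
qed

lemma level_set_interval:
  fixes X :: "nat \<Rightarrow> int"
  assumes X: "\<And>i j. 1 \<le> i \<Longrightarrow> i \<le> j \<Longrightarrow> j \<le> n \<Longrightarrow> X j \<le> X i" and "1 \<le> n"
  obtains b where "1 \<le> b" "b \<le> n" "{i \<in> {1..n}. X i = X n} = {b..n}"
proof -
  let ?B = "{i \<in> {1..n}. X i = X n}"
  have fin: "finite ?B" and ne: "?B \<noteq> {}" using assms(2) by auto
  define b where "b = Min ?B"
  have b: "b \<in> {1..n}" "X b = X n" using Min_in[OF fin ne] unfolding b_def by blast+
  have le: "b \<le> i" if "i \<in> {1..n}" "X i = X n" for i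
    unfolding b_def using that Min_le[OF fin] by simp
  have "?B = {b..n}"
  proof
    show "?B \<subseteq> {b..n}" using le by auto
    show "{b..n} \<subseteq> ?B"
    proof
      fix i assume "i \<in> {b..n}"
      then show "i \<in> ?B" using X[of b i] X[of i n] b by auto
    qed
  qed
  then show thesis using that[of b] b by auto
qed

text \<open>The Young subgroup of the blocks of equal positions of \<open>X\<close>.\<close>

definition level_stab :: "(nat \<Rightarrow> int) \<Rightarrow> nat \<Rightarrow> (nat \<Rightarrow> nat) set" where
  "level_stab X n = {\<tau>. \<tau> permutes {1..n} \<and> (\<forall>j\<in>{1..n}. X (\<tau> j) = X j)}"

lemma level_stabI:
  "\<tau> permutes {1..n} \<Longrightarrow> (\<And>j. j \<in> {1..n} \<Longrightarrow> X (\<tau> j) = X j) \<Longrightarrow> \<tau> \<in> level_stab X n"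
  by (simp add: level_stab_def)

lemma level_stabD:
  assumes "\<tau> \<in> level_stab X n"
  shows "\<tau> permutes {1..n}" "j \<in> {1..n} \<Longrightarrow> X (\<tau> j) = X j"
  using assms unfolding level_stab_def by blast+

text \<open>The cycle moves only indices from b to n + 1, all of which lie in the last
  block.\<close>

lemma insert_last_level_stab:
  assumes b: "b \<in> {1..Suc n}" and \<tau>: "\<tau> \<in> level_stab X n"
    and eqX: "\<And>i. b \<le> i \<Longrightarrow> i \<le> Suc n \<Longrightarrow> X i = X (Suc n)"
  shows "insert_last n b \<circ> \<tau> \<in> level_stab X (Suc n)"
proof (rule level_stabI)
  have p: "\<tau> permutes {1..Suc n}"
    by (rule permutes_subset[OF level_stabD(1)[OF \<tau>]]) auto
  show "insert_last n b \<circ> \<tau> permutes {1..Suc n}"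
    by (rule permutes_compose[OF p insert_last_permutes[OF b]])
  fix j assume j: "j \<in> {1..Suc n}"
  have ins: "X (insert_last n b i) = X i" if "i \<in> {1..Suc n}" for i
    using that eqX[of i] eqX[of "Suc i"] eqX[of b] b by (auto simp: insert_last_def)
  have "X (\<tau> j) = X j"
  proof (cases "j = Suc n")
    case True
    then have "\<tau> j = j"
      by (intro permutes_not_in[OF level_stabD(1)[OF \<tau>]]) simp
    then show ?thesis by simp
  next
    case False
    then show ?thesis using level_stabD(2)[OF \<tau>, of j] j by simp
  qed
  moreover have "\<tau> j \<in> {1..Suc n}" using permutes_in_image[OF p, of j] j by blast
  ultimately show "X ((insert_last n b \<circ> \<tau>) j) = X j"
    using ins[of "\<tau> j"] by (simp only: o_apply)
qed

lemma extract_last_level_stab: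
  assumes \<tau>: "\<tau> \<in> level_stab X (Suc n)" and b: "b = \<tau> (Suc n)"
    and eqX: "\<And>i. b \<le> i \<Longrightarrow> i \<le> Suc n \<Longrightarrow> X i = X (Suc n)"
  shows "extract_last n b \<circ> \<tau> \<in> level_stab X n"
proof (rule level_stabI)
  note p = level_stabD(1)[OF \<tau>]
  have im: "\<tau> j \<in> {1..Suc n}" if "j \<in> {1..Suc n}" for j
    using permutes_in_image[OF p, of j] that by blast
  have b1: "b \<in> {1..Suc n}" unfolding b by (rule im) simp
  have "extract_last n b \<circ> \<tau> permutes {1..Suc n}"
    by (rule permutes_compose[OF p extract_last_permutes[OF b1]])
  moreover have "(extract_last n b \<circ> \<tau>) j = j" if "j \<in> {1..Suc n} - {1..n}" for j
  proof -
    have "j = Suc n" using that by auto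
    then show ?thesis by (simp add: extract_last_def b)
  qed
  ultimately show "extract_last n b \<circ> \<tau> permutes {1..n}"
    by (rule permutes_superset)
  fix j assume "j \<in> {1..n}"
  then have j: "j \<in> {1..Suc n}" by simp
  have "X (extract_last n b i) = X i" if "i \<in> {1..Suc n}" for i
    using that eqX[of i] eqX[of "i - 1"] eqX[of b] b1 by (auto simp: extract_last_def)
  from this[OF im[OF j]] level_stabD(2)[OF \<tau> j]
  show "X ((extract_last n b \<circ> \<tau>) j) = X j" by (simp only: o_apply)
qed

text \<open>A permutation in the stabiliser is determined by its last letter b, which must lie in
  the last block, and by the stabiliser element left after removing it. The letter costs n + 1 - b
  inversions, and summing over the block gives one q-integer, whose argument is the size of the
  block.\<close>

lemma sum_level_stab_inversions:
  fixes X :: "nat \<Rightarrow> int" and q :: real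
  assumes "\<And>i j. 1 \<le> i \<Longrightarrow> i \<le> j \<Longrightarrow> j \<le> n \<Longrightarrow> X j \<le> X i"
  shows "(\<Sum>\<tau>\<in>level_stab X n. q ^ card (ninv n \<tau>))
    = (\<Prod>j=1..n. qint q (card {i \<in> {1..j}. X i = X j}))"
  using assms
proof (induction n)
  case 0
  have "level_stab X 0 = {id}" by (auto simp: level_stab_def)
  moreover have "ninv 0 \<tau> = {}" for \<tau> by (auto simp: ninv_def)
  ultimately show ?case by simp
next
  case (Suc n)
  obtain b0 where b0: "1 \<le> b0" "b0 \<le> Suc n" and B: "{i \<in> {1..Suc n}. X i = X (Suc n)} = {b0..Suc n}"
    by (rule level_set_interval[where X=X and n="Suc n", OF Suc.prems]) auto
  have eqX: "X i = X (Suc n)" if "b0 \<le> i" "i \<le> Suc n" for i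
  proof -
    have "i \<in> {b0..Suc n}" using that by simp
    then show ?thesis unfolding B[symmetric] by blast
  qed
  have b1: "b \<in> {1..Suc n}" if "b \<in> {b0..Suc n}" for b using that b0 by auto
  have eqX': "X i = X (Suc n)" if "b \<in> {b0..Suc n}" "b \<le> i" "i \<le> Suc n" for b i
    by (rule eqX) (use that in auto)
  have last: "\<tau> (Suc n) \<in> {b0..Suc n}" if \<tau>: "\<tau> \<in> level_stab X (Suc n)" for \<tau>
  proof -
    have "X (\<tau> (Suc n)) = X (Suc n)" by (rule level_stabD(2)[OF \<tau>]) simp
    moreover have "\<tau> (Suc n) \<in> {1..Suc n}"
      using permutes_in_image[OF level_stabD(1)[OF \<tau>], of "Suc n"] by simp
    ultimately show ?thesis unfolding B[symmetric] by blast
  qed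
  let ?w = "\<lambda>(b, \<tau>). q ^ (Suc n - b) * q ^ card (ninv n \<tau>)"
  let ?j = "\<lambda>\<tau>. (\<tau> (Suc n), extract_last n (\<tau> (Suc n)) \<circ> \<tau>)"
  let ?i = "\<lambda>(b, \<tau>). insert_last n b \<circ> \<tau>"
  have "(\<Sum>\<tau>\<in>level_stab X (Suc n). q ^ card (ninv (Suc n) \<tau>))
      = (\<Sum>p\<in>{b0..Suc n} \<times> level_stab X n. ?w p)"
  proof (rule sum.reindex_bij_witness[where j = ?j and i = ?i])
    fix \<tau> assume \<tau>: "\<tau> \<in> level_stab X (Suc n)"
    let ?b = "\<tau> (Suc n)"
    note b = b1[OF last[OF \<tau>]]
    have eq: "insert_last n ?b \<circ> (extract_last n ?b \<circ> \<tau>) = \<tau>"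
      by (rule ext) (simp only: o_apply insert_extract_last(1)[OF b])
    then show "?i (?j \<tau>) = \<tau>" by (simp only: prod.case)
    have ext: "extract_last n ?b \<circ> \<tau> \<in> level_stab X n"
      by (rule extract_last_level_stab[OF \<tau> refl eqX'[OF last[OF \<tau>]]])
    then show "?j \<tau> \<in> {b0..Suc n} \<times> level_stab X n"
      using last[OF \<tau>] by blast
    show "?w (?j \<tau>) = q ^ card (ninv (Suc n) \<tau>)"
      using card_ninv_insert_last[OF b level_stabD(1)[OF ext]] unfolding eq
      by (simp only: prod.case power_add mult.commute)
  next
    fix p assume "p \<in> {b0..Suc n} \<times> level_stab X n"
    then obtain b \<tau> where p: "p = (b, \<tau>)" and b: "b \<in> {b0..Suc n}" and \<tau>: "\<tau> \<in> level_stab X n" by blast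
    have "\<tau> (Suc n) = Suc n" by (rule permutes_not_in[OF level_stabD(1)[OF \<tau>]]) simp
    then have "(insert_last n b \<circ> \<tau>) (Suc n) = b" by (simp add: insert_last_def)
    moreover have "extract_last n b \<circ> (insert_last n b \<circ> \<tau>) = \<tau>"
      by (rule ext) (simp only: o_apply insert_extract_last(2)[OF b1[OF b]])
    ultimately show "?j (?i p) = p" by (simp only: p prod.case)
    show "?i p \<in> level_stab X (Suc n)"
      unfolding p prod.case by (rule insert_last_level_stab[OF b1[OF b] \<tau> eqX'[OF b]])
  qed
  also have "\<dots> = (\<Sum>b\<in>{b0..Suc n}. q ^ (Suc n - b)) * (\<Sum>\<tau>\<in>level_stab X n. q ^ card (ninv n \<tau>))"
    by (simp only: sum_product sum.cartesian_product)
  also have "(\<Sum>\<tau>\<in>level_stab X n. q ^ card (ninv n \<tau>)) = (\<Prod>j=1..n. qint q (card {i \<in> {1..j}. X i = X j}))"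
    by (rule Suc.IH) (rule Suc.prems, auto)
  also have "(\<Sum>b\<in>{b0..Suc n}. q ^ (Suc n - b)) = qint q (card {i \<in> {1..Suc n}. X i = X (Suc n)})"
    unfolding B qint_def
    by (rule sum.reindex_bij_witness[where i = "\<lambda>i. Suc n - i" and j = "\<lambda>b. Suc n - b"]) (use b0 in auto)
  finally show ?case by (simp only: prod.nat_ivl_Suc' le_add1 plus_1_eq_Suc)
qed

text \<open>For negative q the terms have both signs, so positivity gives nothing; the closed form
  of the geometric sum is nonzero because |q^k| <= |q| < 1.\<close>

lemma qint_nonzero:
  assumes "\<bar>q\<bar> < 1" "1 \<le> k"
  shows "qint q k \<noteq> 0"
proof -
  have "\<bar>q ^ k\<bar> \<le> \<bar>q\<bar> ^ 1"
    unfolding power_abs using assms by (intro power_decreasing) auto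
  then have "q ^ k \<noteq> 1" using assms(1) by auto
  then show ?thesis
    unfolding qint_def using assms(1) by (subst sum_gp_strict) auto
qed

section \<open>The transition probabilities\<close>

text \<open>Along a block the cardinalities run through 1, 2, up to its size, so the factors of that
  block multiply to its q-factorial.\<close>

lemma prod_qfact_occupied:
  assumes X: "X \<in> confs N"
  shows "(\<Prod>x\<in>occupied N X. qfact q (eta N X x))
    = (\<Prod>j=1..N. qint q (card {i \<in> {1..j}. X i = X j}))"
proof -
  let ?g = "\<lambda>j. qint q (card {i \<in> {1..j}. X i = X j})"
  have "(\<Prod>j=1..N. ?g j) = (\<Prod>x\<in>occupied N X. \<Prod>j | j \<in> {1..N} \<and> X j = x. ?g j)"
    unfolding occupied_def by (rule prod.image_gen) simp
  also have "\<dots> = (\<Prod>x\<in>occupied N X. qfact q (eta N X x))"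
  proof (rule prod.cong[OF refl])
    fix x assume x: "x \<in> occupied N X"
    obtain m where m: "m \<in> {1..N}" "X m = x" "(LEAST j. 1 \<le> j \<and> j \<le> N \<and> X j = x) = m"
      and A: "{j \<in> {1..N}. X j = x} = {m..<m + eta N X x}"
      by (rule confs_fiber[OF X x])
    have mem: "j \<in> {1..N} \<and> X j = x \<longleftrightarrow> m \<le> j \<and> j < m + eta N X x" for j
      using A by (auto simp: set_eq_iff)
    have "?g (m + i) = qint q (Suc i)" if "i < eta N X x" for i
    proof -
      have mi: "m + i \<in> {1..N}" "X (m + i) = x" using mem[of "m + i"] that by auto
      have "{j \<in> {1..m + i}. X j = X (m + i)} = {m..m + i}"
      proof (intro set_eqI iffI)
        fix j assume "j \<in> {j \<in> {1..m + i}. X j = X (m + i)}"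
        then show "j \<in> {m..m + i}" using mem[of j] mi by auto
      next
        fix j assume "j \<in> {m..m + i}"
        then show "j \<in> {j \<in> {1..m + i}. X j = X (m + i)}" using mem[of j] mi that by auto
      qed
      then show ?thesis by simp
    qed
    moreover have "(\<Prod>j\<in>{m..<m + eta N X x}. ?g j) = (\<Prod>i<eta N X x. ?g (m + i))"
      by (rule prod.reindex_bij_witness[where i="\<lambda>i. m + i" and j="\<lambda>j. j - m"]) auto
    ultimately have "(\<Prod>j\<in>{m..<m + eta N X x}. ?g j) = (\<Prod>i<eta N X x. qint q (Suc i))"
      by simp
    also have "\<dots> = qfact q (eta N X x)"
      unfolding qfact_def by (rule prod.reindex_bij_witness[where i="\<lambda>i. i - 1" and j="Suc"]) auto
    finally show "(\<Prod>j | j \<in> {1..N} \<and> X j = x. ?g j) = qfact q (eta N X x)"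
      unfolding A .
  qed
  finally show ?thesis by simp
qed

context qtazrp
begin

lemma weightW_inverse: "weightW N q X * (\<Prod>x\<in>occupied N X. qfact q (eta N X x)) = 1"
proof -
  have "qfact q k \<noteq> 0" for k
    unfolding qfact_def using qint_nonzero[OF q1] by simp
  then have "(\<Prod>x\<in>occupied N X. qfact q (eta N X x)) \<noteq> 0"
    by (simp add: occupied_def)
  then show ?thesis by (simp add: weightW_def)
qed

text \<open>Reindexing moves the permutation from the variables to the exponents, so that each
  variable carries a single power whose sign decides in which direction its contour is
  shifted.\<close>

lemma bethe_term_eq_pair_term:
  assumes \<sigma>: "\<sigma> permutes {1..N}" and z: "z \<in> torus r N"
  shows "bethe_term N q X \<sigma> z * monom_inv N Y z
    = pair_term N q (ninv N (inv \<sigma>)) (\<lambda>j. X (inv \<sigma> j) - Y j) z"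
proof -
  have "(\<Prod>i=1..N. z (\<sigma> i) powi X i) = (\<Prod>j=1..N. z j powi X (inv \<sigma> j))"
    using prod.permute[OF \<sigma>, of "\<lambda>j. z j powi X (inv \<sigma> j)"]
    by (simp add: o_def permutes_inverses(2)[OF \<sigma>])
  then have "(\<Prod>i=1..N. z (\<sigma> i) powi X i) * monom_inv N Y z
      = (\<Prod>j=1..N. z j powi X (inv \<sigma> j) * z j powi (- Y j))"
    by (simp only: monom_inv_def prod.distrib)
  also have "\<dots> = (\<Prod>j=1..N. z j powi (X (inv \<sigma> j) - Y j))"
    by (rule prod.cong[OF refl]) (use torus_nonzero[OF z] in \<open>simp add: power_int_add[symmetric]\<close>)
  finally show ?thesis
    unfolding bethe_term_def pair_term_def Aperm_def inversions_eq_ninv by (simp only: mult.assoc)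
qed

text \<open>The case distinction is on whether the integral vanishes. If it does not, the
  contrapositives of the two vanishing lemmas are exactly the hypotheses \<open>RL\<close> and
  \<open>LR\<close> of \<open>permutation_rigidity\<close>.\<close>

lemma torus_avg_bethe_term:
  assumes X: "X \<in> confs N" and Y: "Y \<in> confs N" and \<sigma>: "\<sigma> permutes {1..N}"
  defines "\<tau> \<equiv> inv \<sigma>"
  shows "torus_avg r N (\<lambda>z. bethe_term N q X \<sigma> z * monom_inv N Y z) (torus_base r N)
    = (if X = Y \<and> \<tau> \<in> level_stab X N then of_real q ^ card (ninv N \<tau>) else 0)"
proof -
  let ?I = "ninv N \<tau>" and ?e = "\<lambda>j. X (\<tau> j) - Y j"
  have \<tau>: "\<tau> permutes {1..N}" unfolding \<tau>_def by (rule permutes_inv[OF \<sigma>])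
  have inj: "\<tau> i = \<tau> j \<longleftrightarrow> i = j" for i j
    by (rule inj_eq[OF permutes_inj[OF \<tau>]])
  have eq: "torus_avg r N (\<lambda>z. bethe_term N q X \<sigma> z * monom_inv N Y z) (torus_base r N)
      = torus_avg r N (pair_term N q ?I ?e) (torus_base r N)"
    unfolding \<tau>_def by (rule torus_avg_cong[OF bethe_term_eq_pair_term[OF \<sigma>] r_ge0 order.refl base])
  have I: "?I \<subseteq> {1..N} \<times> {1..N}" by (auto simp: ninv_def)
  show ?thesis
  proof (cases "torus_avg r N (pair_term N q ?I ?e) (torus_base r N) = 0")
    case True
    \<comment> \<open>In the remaining case the integral would be a power of q, which is nonzero
      since q is.\<close>
    have "X \<noteq> Y" if st: "\<tau> \<in> level_stab X N"
    proof
      assume XY: "X = Y"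
      have "torus_avg r N (pair_term N q ?I ?e) (torus_base r N)
          = torus_avg r N (pair_term N q ?I (\<lambda>_. 0)) (torus_base r N)"
      proof -
        have "pair_term N q ?I ?e = pair_term N q ?I (\<lambda>_. 0)"
          unfolding pair_term_def XY using level_stabD(2)[OF st] XY by (intro ext) simp
        then show ?thesis by simp
      qed
      also have "\<dots> = of_real q ^ card ?I"
        by (rule torus_avg_Sfac_prod[where n=N]) (auto simp: ninv_def)
      finally show False using True q0 by simp
    qed
    then show ?thesis using True eq by auto
  next
    case False
    have RL: "X (\<tau> k) \<le> Y k" if k: "k \<in> {1..N}" and min: "\<And>j. k < j \<Longrightarrow> j \<le> N \<Longrightarrow> \<tau> k < \<tau> j" for k
    proof (rule ccontr)
      assume "\<not> ?thesis"
      then have e: "0 < ?e k" by simp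
      have "torus_avg r N (pair_term N q ?I ?e) (torus_base r N) = 0"
      proof (rule torus_avg_inside_vanishes[where e="?e", OF I k _ e])
        \<comment> \<open>An inversion with first index k needs a later, smaller value, which a
          right-to-left minimum excludes.\<close>
        show "\<alpha> \<noteq> k" if "(\<alpha>, \<beta>) \<in> ?I" for \<alpha> \<beta>
          using that min[of \<beta>] by (auto simp: ninv_def)
      qed
      with False show False by contradiction
    qed
    have LR: "Y k \<le> X (\<tau> k)" if k: "k \<in> {1..N}" and max: "\<And>j. 1 \<le> j \<Longrightarrow> j < k \<Longrightarrow> \<tau> j < \<tau> k" for k
    proof (rule ccontr)
      assume "\<not> ?thesis"
      then have e: "?e k < 0" by simp
      have "torus_avg r N (pair_term N q ?I ?e) (torus_base r N) = 0"
      proof (rule torus_avg_outside_vanishes[where e="?e", OF I k _ e])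
        \<comment> \<open>An inversion with second index k needs an earlier, larger value, which a
          left-to-right maximum excludes.\<close>
        show "\<beta> \<noteq> k" if "(\<alpha>, \<beta>) \<in> ?I" for \<alpha> \<beta>
          using that max[of \<alpha>] by (auto simp: ninv_def)
      qed
      with False show False by contradiction
    qed
    have rig1: "X j = Y j" if "j \<in> {1..N}" for j
      by (rule permutation_rigidity(1)[where X=X and Y=Y and \<tau>=\<tau> and N=N,
        OF \<tau> confs_antimono[OF X] confs_antimono[OF Y] RL LR that])
    have rig2: "X (\<tau> j) = X j" if "j \<in> {1..N}" for j
      by (rule permutation_rigidity(2)[where X=X and Y=Y and \<tau>=\<tau> and N=N,
        OF \<tau> confs_antimono[OF X] confs_antimono[OF Y] RL LR that])
    have XY: "X = Y"
    proof
      show "X j = Y j" for j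
      proof (cases "j \<in> {1..N}")
        case False
        then have "j = 0 \<or> N < j" by auto
        then have "X j = 0" "Y j = 0" using X Y unfolding confs_def by blast+
        then show ?thesis by simp
      qed (rule rig1)
    qed
    have st: "\<tau> \<in> level_stab X N" by (rule level_stabI[OF \<tau>]) (rule rig2)
    have "pair_term N q ?I ?e = pair_term N q ?I (\<lambda>_. 0)"
      unfolding pair_term_def XY using level_stabD(2)[OF st] XY by (intro ext) simp
    then have "torus_avg r N (pair_term N q ?I ?e) (torus_base r N) = of_real q ^ card ?I"
      using torus_avg_Sfac_prod[of ?I N] by (auto simp: ninv_def)
    then show ?thesis using eq XY st by simp
  qed
qed

lemma amplitude_initial:
  assumes X: "X \<in> confs N" and Y: "Y \<in> confs N"
  shows "of_real (weightW N q X) * amplitude X 0 Y = (if Y = X then 1 else 0)"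
proof -
  let ?P = "{\<sigma>. \<sigma> permutes {1..N}}"
  have fin: "finite ?P" by (simp add: finite_permutations)
  have "amplitude X 0 Y
      = torus_avg r N (\<lambda>z. \<Sum>\<sigma>\<in>?P. bethe_term N q X \<sigma> z * monom_inv N Y z) (torus_base r N)"
    unfolding amplitude_def bethe_def by (simp only: sum_distrib_right power_0 mult_1_right)
  also have "\<dots> = (\<Sum>\<sigma>\<in>?P. torus_avg r N (\<lambda>z. bethe_term N q X \<sigma> z * monom_inv N Y z) (torus_base r N))"
    by (rule torus_avg_sum[OF fin _ r_ge0 order.refl base])
       (intro continuous_on_mult continuous_on_bethe_term continuous_on_monom_inv, simp)
  also have "\<dots> = (\<Sum>\<sigma>\<in>?P. if X = Y \<and> inv \<sigma> \<in> level_stab X N then of_real q ^ card (ninv N (inv \<sigma>)) else 0)"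
    by (rule sum.cong[OF refl]) (simp add: torus_avg_bethe_term[OF X Y])
  also have "\<dots> = (\<Sum>\<tau>\<in>?P. if X = Y \<and> \<tau> \<in> level_stab X N then of_real q ^ card (ninv N \<tau>) else 0)"
    by (rule sum.reindex_bij_witness[where i=inv and j=inv])
       (auto simp: permutes_inv permutes_inv_inv)
  finally have amp: "amplitude X 0 Y
      = (\<Sum>\<tau>\<in>?P. if X = Y \<and> \<tau> \<in> level_stab X N then of_real q ^ card (ninv N \<tau>) else 0)" .
  show ?thesis
  proof (cases "X = Y")
    case True
    have "amplitude X 0 Y = (\<Sum>\<tau>\<in>?P \<inter> level_stab X N. of_real q ^ card (ninv N \<tau>))"
      unfolding amp using fin True by (simp add: sum.inter_restrict)
    also have "?P \<inter> level_stab X N = level_stab X N"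
      by (auto simp: level_stab_def)
    also have "(\<Sum>\<tau>\<in>level_stab X N. of_real q ^ card (ninv N \<tau>))
        = (of_real (\<Sum>\<tau>\<in>level_stab X N. q ^ card (ninv N \<tau>)) :: complex)"
      by simp
    also have "(\<Sum>\<tau>\<in>level_stab X N. q ^ card (ninv N \<tau>)) = (\<Prod>x\<in>occupied N X. qfact q (eta N X x))"
      unfolding prod_qfact_occupied[OF X] by (rule sum_level_stab_inversions[OF confs_antimono[OF X]])
    finally show ?thesis
      using weightW_inverse[of X] True by (simp only: of_real_mult[symmetric] of_real_1 if_True simp_thms)
  next
    case False
    then show ?thesis unfolding amp by simp
  qed
qed

text \<open>Both sides obey the same recursion in n on ordered configurations. The induction runs
  over all starting points at once, since one application of the generator evaluates at the jumps of
  \<open>Y\<close>, which are ordered again.\<close>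

lemma gen_power_eq_amplitude:
  assumes X: "X \<in> confs N" and Y: "Y \<in> confs N"
  shows "complex_of_real ((gen N q ^^ n) (\<lambda>Z. if Z = X then 1 else 0) Y)
    = of_real (weightW N q X) * amplitude X n Y"
  using Y
proof (induction n arbitrary: Y)
  case 0
  then show ?case using amplitude_initial[OF X 0] by simp
next
  case (Suc n)
  let ?f = "(gen N q ^^ n) (\<lambda>Z. if Z = X then 1 else 0)"
  let ?W = "complex_of_real (weightW N q X)"
  have "complex_of_real ((gen N q ^^ Suc n) (\<lambda>Z. if Z = X then 1 else 0) Y)
      = (\<Sum>x\<in>occupied N Y. of_real (qint q (eta N Y x)) * (of_real (?f (jump N Y x)) - of_real (?f Y)))"
    by (simp add: gen_def)
  also have "\<dots> = (\<Sum>x\<in>occupied N Y. of_real (qint q (eta N Y x)) *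
      (?W * amplitude X n (jump N Y x) - ?W * amplitude X n Y))"
    by (rule sum.cong[OF refl]) (simp only: Suc.IH[OF Suc.prems] Suc.IH[OF jump_in_confs[OF Suc.prems]])
  also have "\<dots> = ?W * amplitude X (Suc n) Y"
    unfolding amplitude_backward[OF Suc.prems] sum_distrib_left
    by (rule sum.cong[OF refl]) (simp only: right_diff_distrib mult_ac)
  finally show ?case .
qed

text \<open>The product of the \<open>z i\<close> that comes from the angular measure is invariant
  under \<sigma> and raises each exponent by one, cancelling the -1.\<close>

lemma integrand_eq:
  assumes z: "z \<in> torus r N"
  shows "(\<Sum>\<sigma>\<in>{\<sigma>. \<sigma> permutes {1..N}}. Aperm N q \<sigma> z *
      (\<Prod>i=1..N. z (\<sigma> i) powi (X i - Y (\<sigma> i) - 1) * exp (epsilon (z i) * t))) * (\<Prod>i=1..N. z i)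
    = bethe N q X z * monom_inv N Y z * exp (t * energy N z)"
  unfolding bethe_def sum_distrib_right
proof (rule sum.cong[OF refl])
  fix \<sigma> assume "\<sigma> \<in> {\<sigma>. \<sigma> permutes {1..N}}"
  then have \<sigma>: "\<sigma> permutes {1..N}" by blast
  have "z (\<sigma> i) powi (X i - Y (\<sigma> i) - 1) * z (\<sigma> i) = z (\<sigma> i) powi X i * z (\<sigma> i) powi (- Y (\<sigma> i))"
    if "i \<in> {1..N}" for i
  proof -
    have "z (\<sigma> i) \<noteq> 0"
      using torus_nonzero[OF z] permutes_in_image[OF \<sigma>, of i] that by blast
    then show ?thesis by (simp add: power_int_diff power_int_minus divide_inverse)
  qed
  then have "(\<Prod>i=1..N. z (\<sigma> i) powi (X i - Y (\<sigma> i) - 1)) * (\<Prod>i=1..N. z (\<sigma> i))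
      = (\<Prod>i=1..N. z (\<sigma> i) powi X i) * (\<Prod>i=1..N. z (\<sigma> i) powi (- Y (\<sigma> i)))"
    unfolding prod.distrib[symmetric] by (intro prod.cong) auto
  moreover have "(\<Prod>i=1..N. z (\<sigma> i)) = (\<Prod>i=1..N. z i)"
    using prod.permute[OF \<sigma>, of z] by (simp add: o_def)
  moreover have "(\<Prod>i=1..N. z (\<sigma> i) powi (- Y (\<sigma> i))) = monom_inv N Y z"
    unfolding monom_inv_def using prod.permute[OF \<sigma>, of "\<lambda>j. z j powi (- Y j)"] by (simp add: o_def)
  ultimately have "(\<Prod>i=1..N. z (\<sigma> i) powi (X i - Y (\<sigma> i) - 1)) * (\<Prod>i=1..N. z i)
      = (\<Prod>i=1..N. z (\<sigma> i) powi X i) * monom_inv N Y z"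
    by (simp only:)
  moreover have "(\<Prod>i=1..N. exp (epsilon (z i) * t)) = exp (t * energy N z)"
    unfolding energy_def sum_distrib_left by (simp add: exp_sum mult.commute)
  ultimately show "Aperm N q \<sigma> z * (\<Prod>i=1..N. z (\<sigma> i) powi (X i - Y (\<sigma> i) - 1) * exp (epsilon (z i) * t))
        * (\<Prod>i=1..N. z i)
      = bethe_term N q X \<sigma> z * monom_inv N Y z * exp (t * energy N z)"
    unfolding bethe_term_def prod.distrib by (simp add: mult_ac)
qed

end

theorem theorem1:
  fixes N :: nat and q r t :: real and X Y :: "nat \<Rightarrow> int"
  assumes "N \<ge> 1"
    and "0 < \<bar>q\<bar>" and "\<bar>q\<bar> < 1"
    and "0 < r" and "r < (1 - \<bar>q\<bar>) / \<bar>1 - q\<bar>"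
    and "X \<in> confs N" and "Y \<in> confs N"
    and "t \<ge> 0"
  shows "complex_of_real (trans_prob N q Y X t) =
    complex_of_real (weightW N q X) * (1 / (2 * of_real pi * \<i>)) ^ N *
    multi_circle_integral r N (\<lambda>z.
      \<Sum>\<sigma>\<in>{\<sigma>. \<sigma> permutes {1..N}}.
        Aperm N q \<sigma> z *
        (\<Prod>i=1..N. z (\<sigma> i) powi (X i - Y (\<sigma> i) - 1) * exp (epsilon (z i) * of_real t)))"
proof -
  interpret qtazrp N q r
    by unfold_locales (use assms in auto)
  let ?F = "\<lambda>z. bethe N q X z * monom_inv N Y z"
  let ?W = "complex_of_real (weightW N q X)"
  let ?g = "\<lambda>n. (gen N q ^^ n) (\<lambda>Z. if Z = X then 1 else 0) Y"
  let ?K = "torus_avg r N (\<lambda>z. ?F z * exp (of_real t * energy N z)) (torus_base r N)"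
  have "(\<lambda>n. of_real t ^ n / fact n * torus_avg r N (\<lambda>z. ?F z * energy N z ^ n) (torus_base r N)) sums ?K"
    by (rule torus_avg_exp_series[OF _ continuous_on_energy r_ge0 base])
       (intro continuous_on_mult continuous_on_bethe continuous_on_monom_inv)
  then have "(\<lambda>n. ?W * (of_real t ^ n / fact n * amplitude X n Y)) sums (?W * ?K)"
    unfolding amplitude_def by (rule sums_mult)
  moreover have "?W * (of_real t ^ n / fact n * amplitude X n Y) = of_real (t ^ n / fact n * ?g n)" for n
    using gen_power_eq_amplitude[OF assms(6,7), of n] by simp
  ultimately have sums: "(\<lambda>n. complex_of_real (t ^ n / fact n * ?g n)) sums (?W * ?K)"
    by (simp only:)
  \<comment> \<open>\<open>trans_prob\<close> is defined by an infinite sum of reals; its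
    convergence is read off from the complex series by taking real parts.\<close>
  have "summable (\<lambda>n. t ^ n / fact n * ?g n)"
    using summable_Re[OF sums_summable[OF sums]] by (simp only: Re_complex_of_real)
  then have "(\<lambda>n. t ^ n / fact n * ?g n) sums trans_prob N q Y X t"
    unfolding trans_prob_def by (rule summable_sums)
  then have "complex_of_real (trans_prob N q Y X t) = ?W * ?K"
    using sums sums_of_real sums_unique2 by blast
  also have "?K = (1 / (2 * of_real pi * \<i>)) ^ N * multi_circle_integral r N (\<lambda>z.
      \<Sum>\<sigma>\<in>{\<sigma>. \<sigma> permutes {1..N}}. Aperm N q \<sigma> z *
        (\<Prod>i=1..N. z (\<sigma> i) powi (X i - Y (\<sigma> i) - 1) * exp (epsilon (z i) * of_real t)))"
    unfolding multi_circle_integral_eq_base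
    by (rule torus_avg_cong[OF integrand_eq[symmetric] r_ge0 order.refl base])
  finally show ?thesis by (simp only: mult.assoc)
qed

end
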